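(* Let $X=(X_t)_{t\ge 0}$ be a time-homogeneous continuous-time Markov chain with finite or countably infinite state space $\mathbb{X}\subset[0,\infty)$, and let $\delta$ be a discount function. Let $S_0:=\emptyset$ and, for $n\ge 0$, $$S_{n+1}:=S_n\cup\Big\{x\in\mathbb{X}\setminus S_n:\ x>\sup_{S:\,S_n\subset S\subset\mathbb{X}\setminus\{x\}}J(x,S)\Big\},\qquad S_\infty:=\bigcup_{n=0}^\infty S_n.$$ If $\sup\mathbb{X}<\infty$, $\sup_{x\in\mathbb{X}}\lambda_x<\infty$, and $\delta(s)\delta(t)\le\delta(s+t)$ for all $s,t>0$, then $S_\infty$ is an optimal mild equilibrium. If in addition $\delta$ is differentiable at $t=0$ with $\delta'(0)<0$, then $S_\infty$ is a strong equilibrium.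
   Context: For $x\in\mathbb{X}$, $\lambda_x$ is the total transition rate out of $x$ and $q_{xy}$ the transition rate from $x$ to $y\neq x$, so $\lambda_x=\sum_{y\ne x}q_{xy}$. $\mathbb{E}_x$ is expectation given $X_0=x$; the filtration is generated by $X$; paths are right-continuous with finitely many jumps on bounded time intervals. A discount function is a decreasing function $\delta:[0,\infty)\to[0,1]$ with $\delta(0)=1$ and $\lim_{t\to\infty}\delta(t)=0$; it is assumed to be non-exponential (not of the form $e^{-rt}$). For $S\subset\mathbb{X}$: $\tau_S:=\inf\{t\ge 0:X_t\in S\}$, $\tau_S^{\varepsilon}:=\inf\{t\ge\varepsilon:X_t\in S\}$ for $\varepsilon>0$, and $J(x,S):=\mathbb{E}_x[\delta(\tau_S)X_{\tau_S}]$, with $\delta(\tau)X_\tau:=0$ on $\{\tau=\infty\}$ (so $J(x,S)=x$ for $x\in S$ and $J(x,\emptyset)=0$). Mild equilibrium: $S\subset\mathbb{X}$ with $x\le J(x,S)$ for all $x\notin S$. Optimal mild equilibrium: a mild equilibrium $S^*$ such that $J(x,S^* )\ge J(x,S)$ for every mild equilibrium $S$ and every $x\in\mathbb{X}$. Strong equilibrium: $S\subset\mathbb{X}$ such that $x\le J(x,S)$ for all $x\notin S$, and for every $x\in S$ there is $\varepsilon=\varepsilon(x)>0$ such that $x\ge\mathbb{E}_x[\delta(\tau_S^{\varepsilon'})X_{\tau_S^{\varepsilon'}}]$ for all $\varepsilon'\in(0,\varepsilon)$. *)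

theory Defs
  imports "HOL-Probability.Probability"
begin

definition history :: "'w measure \<Rightarrow> (real \<Rightarrow> 'w \<Rightarrow> real) \<Rightarrow> real \<Rightarrow> 'w set set" where
  "history M X s =
     sigma_sets (space M) (\<Union>u\<in>{0..s}. {X u -` B \<inter> space M |B. B \<in> sets borel})"

definition trans_prob ::
    "'w measure \<Rightarrow> (real \<Rightarrow> 'w measure) \<Rightarrow> (real \<Rightarrow> 'w \<Rightarrow> real) \<Rightarrow> real \<Rightarrow> real \<Rightarrow> real \<Rightarrow> real" where
  "trans_prob M P X t x y = measure (P x) {\<omega> \<in> space M. X t \<omega> = y}"

text \<open>
  Time-homogeneous continuous-time Markov chains with countable state space \<open>\<X>\<close>: \<open>P x\<close> is the law
  of the chain started at \<open>x\<close>, a probability measure on the common measurable space \<open>M\<close>. Only times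
  \<open>t \<ge> 0\<close> and starting points \<open>x \<in> \<X>\<close> matter.

  Right-continuity and jumps refer to the topology of the reals. As \<open>\<X>\<close> is countable, a path is
  constant between consecutive discontinuities, so this is the same as being a right-continuous step
  function with finitely many jumps on bounded time intervals.

  The assumptions \<open>rate\<close>, \<open>total_rate\<close> and \<open>total_rate_sum\<close> only say what \<open>q\<close> and \<open>\<Lambda>\<close> are: for a
  chain with such paths these derivatives exist and are finite, and the rates are conservative.
\<close>

locale ctmc =
  fixes \<X> :: "real set"
    and M :: "'w measure"
    and P :: "real \<Rightarrow> 'w measure"
    and X :: "real \<Rightarrow> 'w \<Rightarrow> real"
    and q :: "real \<Rightarrow> real \<Rightarrow> real"
    and \<Lambda> :: "real \<Rightarrow> real"
  assumes countable_states: "countable \<X>"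
    and states_nonneg: "\<X> \<subseteq> {0..}"
    and prob_space_P: "x \<in> \<X> \<Longrightarrow> prob_space (P x)"
    and sets_P: "x \<in> \<X> \<Longrightarrow> sets (P x) = sets M"
    and measurable_X: "0 \<le> t \<Longrightarrow> X t \<in> borel_measurable M"
    and X_in_states: "0 \<le> t \<Longrightarrow> \<omega> \<in> space M \<Longrightarrow> X t \<omega> \<in> \<X>"
    and right_continuous: "0 \<le> t \<Longrightarrow> \<omega> \<in> space M \<Longrightarrow> continuous (at_right t) (\<lambda>s. X s \<omega>)"
    and finitely_many_jumps: "\<omega> \<in> space M \<Longrightarrow> finite {t \<in> {0<..T}. \<not> isCont (\<lambda>s. X s \<omega>) t}"
    and start: "x \<in> \<X> \<Longrightarrow> trans_prob M P X 0 x x = 1"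
    and markov: "\<lbrakk>x \<in> \<X>; y \<in> \<X>; z \<in> \<X>; 0 \<le> s; 0 \<le> t; A \<in> history M X s\<rbrakk> \<Longrightarrow>
      measure (P x) {\<omega> \<in> A. X s \<omega> = z \<and> X (s + t) \<omega> = y} =
        measure (P x) {\<omega> \<in> A. X s \<omega> = z} * trans_prob M P X t z y"
    and rate: "\<lbrakk>x \<in> \<X>; y \<in> \<X>; x \<noteq> y\<rbrakk> \<Longrightarrow>
      ((\<lambda>t. trans_prob M P X t x y) has_real_derivative q x y) (at 0 within {0..})"
    and total_rate: "x \<in> \<X> \<Longrightarrow>
      ((\<lambda>t. trans_prob M P X t x x) has_real_derivative - \<Lambda> x) (at 0 within {0..})"
    and total_rate_sum: "x \<in> \<X> \<Longrightarrow> (q x has_sum \<Lambda> x) (\<X> - {x})"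

definition discount_function :: "(real \<Rightarrow> real) \<Rightarrow> bool" where
  "discount_function \<delta> \<longleftrightarrow>
     antimono_on {0..} \<delta> \<and> \<delta> ` {0..} \<subseteq> {0..1} \<and> \<delta> 0 = 1 \<and> (\<delta> \<longlongrightarrow> 0) at_top \<and>
     \<not> (\<exists>r. \<forall>t\<ge>0. \<delta> t = exp (- r * t))"

text \<open>
  First entrance time into \<open>S\<close> from time \<open>\<epsilon>\<close> on, equal to \<open>\<infinity>\<close> if there is none. The time \<open>\<tau>\<^sub>S\<close> is the
  case \<open>\<epsilon> = 0\<close>.
\<close>

definition hitting_time ::
    "(real \<Rightarrow> 'w \<Rightarrow> real) \<Rightarrow> real set \<Rightarrow> real \<Rightarrow> 'w \<Rightarrow> ereal" where
  "hitting_time X S \<epsilon> \<omega> = Inf (ereal ` {t. \<epsilon> \<le> t \<and> X t \<omega> \<in> S})"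

definition stopped_payoff ::
    "(real \<Rightarrow> 'w \<Rightarrow> real) \<Rightarrow> (real \<Rightarrow> real) \<Rightarrow> ('w \<Rightarrow> ereal) \<Rightarrow> 'w \<Rightarrow> real" where
  "stopped_payoff X \<delta> \<tau> \<omega> =
     (if \<tau> \<omega> = \<infinity> then 0 else \<delta> (real_of_ereal (\<tau> \<omega>)) * X (real_of_ereal (\<tau> \<omega>)) \<omega>)"

definition J_from ::
    "(real \<Rightarrow> 'w measure) \<Rightarrow> (real \<Rightarrow> 'w \<Rightarrow> real) \<Rightarrow> (real \<Rightarrow> real) \<Rightarrow> real \<Rightarrow> real \<Rightarrow> real set \<Rightarrow> real" where
  "J_from P X \<delta> \<epsilon> x S = (\<integral>\<omega>. stopped_payoff X \<delta> (hitting_time X S \<epsilon>) \<omega> \<partial>P x)"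

definition J ::
    "(real \<Rightarrow> 'w measure) \<Rightarrow> (real \<Rightarrow> 'w \<Rightarrow> real) \<Rightarrow> (real \<Rightarrow> real) \<Rightarrow> real \<Rightarrow> real set \<Rightarrow> real" where
  "J P X \<delta> x S = J_from P X \<delta> 0 x S"

definition mild_equilibrium ::
    "real set \<Rightarrow> (real \<Rightarrow> 'w measure) \<Rightarrow> (real \<Rightarrow> 'w \<Rightarrow> real) \<Rightarrow> (real \<Rightarrow> real) \<Rightarrow> real set \<Rightarrow> bool" where
  "mild_equilibrium \<X> P X \<delta> S \<longleftrightarrow> S \<subseteq> \<X> \<and> (\<forall>x\<in>\<X> - S. x \<le> J P X \<delta> x S)"

definition optimal_mild_equilibrium ::
    "real set \<Rightarrow> (real \<Rightarrow> 'w measure) \<Rightarrow> (real \<Rightarrow> 'w \<Rightarrow> real) \<Rightarrow> (real \<Rightarrow> real) \<Rightarrow> real set \<Rightarrow> bool" where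
  "optimal_mild_equilibrium \<X> P X \<delta> S' \<longleftrightarrow>
     mild_equilibrium \<X> P X \<delta> S' \<and>
     (\<forall>S. mild_equilibrium \<X> P X \<delta> S \<longrightarrow> (\<forall>x\<in>\<X>. J P X \<delta> x S' \<ge> J P X \<delta> x S))"

definition strong_equilibrium ::
    "real set \<Rightarrow> (real \<Rightarrow> 'w measure) \<Rightarrow> (real \<Rightarrow> 'w \<Rightarrow> real) \<Rightarrow> (real \<Rightarrow> real) \<Rightarrow> real set \<Rightarrow> bool" where
  "strong_equilibrium \<X> P X \<delta> S \<longleftrightarrow>
     S \<subseteq> \<X> \<and> (\<forall>x\<in>\<X> - S. x \<le> J P X \<delta> x S) \<and>
     (\<forall>x\<in>S. \<exists>\<epsilon>>0. \<forall>\<epsilon>'\<in>{0<..<\<epsilon>}. x \<ge> J_from P X \<delta> \<epsilon>' x S)"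

text \<open>
  The supremum below is a supremum of reals, hence meaningful only for a family that is bounded above
  (it is never empty, as \<open>S = S\<^sub>n\<close> is admissible). If \<open>\<X>\<close> is bounded above then so is \<open>J\<close>.
\<close>

primrec S_iter ::
    "real set \<Rightarrow> (real \<Rightarrow> 'w measure) \<Rightarrow> (real \<Rightarrow> 'w \<Rightarrow> real) \<Rightarrow> (real \<Rightarrow> real) \<Rightarrow> nat \<Rightarrow> real set" where
  "S_iter \<X> P X \<delta> 0 = {}"
| "S_iter \<X> P X \<delta> (Suc n) = S_iter \<X> P X \<delta> n \<union>
     {x \<in> \<X> - S_iter \<X> P X \<delta> n.
        x > (SUP S \<in> {S. S_iter \<X> P X \<delta> n \<subseteq> S \<and> S \<subseteq> \<X> - {x}}. J P X \<delta> x S)}"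

definition S_infinity ::
    "real set \<Rightarrow> (real \<Rightarrow> 'w measure) \<Rightarrow> (real \<Rightarrow> 'w \<Rightarrow> real) \<Rightarrow> (real \<Rightarrow> real) \<Rightarrow> real set" where
  "S_infinity \<X> P X \<delta> = (\<Union>n. S_iter \<X> P X \<delta> n)"

end

theory Submission
  imports Defs
begin

text \<open>
  Supermultiplicativity of \<open>\<delta>\<close> and the strong Markov property give \<open>J(x, A) \<ge> E\<^sub>x[\<delta>(\<tau>\<^sub>S) J(X\<^bsub>\<tau>\<^sub>S\<^esub>, A)]\<close>
  for \<open>A \<subseteq> S\<close>: delaying the stop pays. As the rates are bounded, \<open>E\<^sub>x[\<delta>(\<tau>\<^sub>S)] \<le> c < 1\<close> for all
  \<open>x \<notin> S\<close>. For \<open>x \<notin> S\<^sub>\<infinity>\<close> choose \<open>S \<supseteq> S\<^sub>n\<close> with \<open>x \<notin> S\<close> and \<open>J(x, S)\<close> almost \<open>x\<close>; replacing \<open>S\<close> by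
  \<open>S \<union> S\<^sub>\<infinity>\<close> costs little, as \<open>S\<^sub>\<infinity> - S\<^sub>n\<close> is reached late for large \<open>n\<close>. So
  \<open>a = sup (x - J(x, S\<^sub>\<infinity>))\<close> satisfies \<open>a \<le> a * c\<close>, whence \<open>S\<^sub>\<infinity>\<close> is mild. It is contained in every mild
  equilibrium, hence optimal.

  For \<open>x \<in> S\<^sub>\<infinity>\<close> put \<open>A = S\<^sub>\<infinity> - {x}\<close> and \<open>w = J(x, A)\<close>, so that \<open>w < x\<close>. The first-step inequality
  for \<open>A\<close> gives \<open>\<Sum> q\<^sub>x\<^sub>y J(y, A) \<le> (\<lambda>\<^sub>x - \<delta>'(0)) w\<close>, and \<open>J(y, S\<^sub>\<infinity>) - J(y, A) \<le> x - w\<close>. So the right derivative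
  at \<open>\<epsilon> = 0\<close> of an upper bound for \<open>E\<^sub>x[\<delta>(\<tau>\<^sup>\<epsilon>) X\<^bsub>\<tau>\<^sup>\<epsilon>\<^esub>]\<close>, which equals \<open>x\<close> at \<open>\<epsilon> = 0\<close>, is at most
  \<open>\<delta>'(0) (x - w) < 0\<close> up to an arbitrarily small error.

  Both arguments are run first on the time grids \<open>h\<nat>\<close>, where the Markov property applies directly. In the
  limit \<open>h \<rightarrow> 0\<close> the discontinuities of \<open>\<delta>\<close> do not matter: there are countably many of them, and the
  hitting time has no atom after its starting time.
\<close>

text \<open>Shifting row \<open>k\<close> to the right by \<open>k\<close> places turns the
  diagonals \<open>k + j = m\<close> into columns; Tonelli then exchanges the two sums. This
  regroups stopping in two stages by the total number of grid steps.\<close>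

lemma suminf_ennreal_diagonal_le:
  fixes c :: "nat \<Rightarrow> nat \<Rightarrow> ennreal"
  shows "(\<Sum>k. \<Sum>j. c k j) \<le> (\<Sum>m. \<Sum>k\<le>m. c k (m - k))"
proof -
  define b where "b k m = (if k \<le> m then c k (m - k) else 0)" for k m
  have row: "(\<Sum>j. c k j) \<le> (\<Sum>m. b k m)" for k
  proof (rule suminf_le_const)
    fix J
    have "sum (c k) {..<J} = sum (\<lambda>j. b k (j + k)) {..<J}" by (simp add: b_def)
    also have "\<dots> = sum (b k) {k..<J + k}"
      using sum.shift_bounds_nat_ivl[of "b k" 0 k J] by (simp add: atLeast0LessThan)
    also have "\<dots> \<le> sum (b k) {..<J + k}" by (intro sum_mono2) auto
    also have "\<dots> \<le> (\<Sum>m. b k m)" by (intro sum_le_suminf) auto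
    finally show "sum (c k) {..<J} \<le> (\<Sum>m. b k m)" .
  qed auto
  have "(\<Sum>k. \<Sum>j. c k j) \<le> (\<Sum>k. \<Sum>m. b k m)"
    by (intro suminf_le row) auto
  also have "\<dots> = (\<Sum>m. \<Sum>k. b k m)"
    using nn_integral_suminf[of "\<lambda>m k. b k m" "count_space UNIV"]
    by (simp add: nn_integral_count_space_nat)
  also have "\<dots> = (\<Sum>m. \<Sum>k\<le>m. c k (m - k))"
  proof (rule suminf_cong)
    fix m
    show "(\<Sum>k. b k m) = (\<Sum>k\<le>m. c k (m - k))"
      by (subst suminf_finite[of "{..m}"]) (auto simp: b_def)
  qed
  finally show ?thesis .
qed

context ctmc
begin

subsection \<open>Step paths and hitting times\<close>

text \<open>The image of an interval without jumps is connected, and a connected subset of the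
  countable state space has at most one point. At the left end right-continuity suffices.\<close>

lemma path_const:
  assumes \<omega>: "\<omega> \<in> space M" and ab: "0 \<le> a" "a \<le> b"
    and cont: "\<And>t. a < t \<Longrightarrow> t \<le> b \<Longrightarrow> isCont (\<lambda>s. X s \<omega>) t"
  shows "X b \<omega> = X a \<omega>"
proof (rule ccontr)
  assume ne: "X b \<omega> \<noteq> X a \<omega>"
  then have "a < b" using ab by (cases "a = b") auto
  have "continuous_on {a..b} (\<lambda>s. X s \<omega>)"
    unfolding continuous_on_eq_continuous_within
  proof
    fix t assume t: "t \<in> {a..b}"
    show "continuous (at t within {a..b}) (\<lambda>s. X s \<omega>)"
    proof (cases "t = a")
      case True
      with right_continuous[OF ab(1) \<omega>] \<open>a < b\<close> show ?thesis
        by (simp add: at_within_Icc_at_right)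
    next
      case False
      with t cont[of t] show ?thesis
        by (auto intro: continuous_at_imp_continuous_at_within)
    qed
  qed
  then have "connected ((\<lambda>s. X s \<omega>) ` {a..b})"
    by (intro connected_continuous_image) auto
  then have "uncountable ((\<lambda>s. X s \<omega>) ` {a..b})"
    using ne ab by (intro connected_uncountable[of _ "X b \<omega>" "X a \<omega>"]) auto
  moreover have "(\<lambda>s. X s \<omega>) ` {a..b} \<subseteq> \<X>"
    using X_in_states[OF _ \<omega>] ab by auto
  ultimately show False
    using countable_states countable_subset by blast
qed

text \<open>Only finitely many jumps fall into the window \<open>{t<..t+1}\<close>, so the first of
  them, or the end of the window if there is none, lies strictly after \<open>t\<close>.\<close>

lemma path_right_const:
  assumes \<omega>: "\<omega> \<in> space M" and t: "0 \<le> t"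
  obtains \<eta> where "\<eta> > 0" "\<And>u. t \<le> u \<Longrightarrow> u < t + \<eta> \<Longrightarrow> X u \<omega> = X t \<omega>"
proof -
  define D where "D = {u \<in> {0<..t+1}. \<not> isCont (\<lambda>s. X s \<omega>) u} \<inter> {t<..}"
  define m where "m = Min (insert (t+1) D)"
  have fin: "finite D" unfolding D_def using finitely_many_jumps[OF \<omega>] by auto
  then have "m > t" unfolding m_def by (auto simp: D_def)
  moreover have "X u \<omega> = X t \<omega>" if "t \<le> u" "u < m" for u
  proof (rule path_const[OF \<omega> t that(1)])
    fix v assume v: "t < v" "v \<le> u"
    have "m \<le> t + 1" unfolding m_def using fin by auto
    show "isCont (\<lambda>s. X s \<omega>) v"
    proof (rule ccontr)
      assume "\<not> ?thesis"
      then have "v \<in> D" using v that t \<open>m \<le> t + 1\<close> by (auto simp: D_def)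
      then have "m \<le> v" unfolding m_def using fin by auto
      then show False using v that by simp
    qed
  qed
  ultimately show thesis using that[of "m - t"] by (metis add_diff_cancel_left' add_diff_eq diff_gt_0_iff_gt)
qed

text \<open>Each value equals the value at the last jump before it, or at time 0 if there is none,
  and there are finitely many jumps.\<close>

lemma path_finite_range:
  assumes \<omega>: "\<omega> \<in> space M"
  shows "finite ((\<lambda>u. X u \<omega>) ` {0..T})"
proof -
  define D where "D = insert 0 {u \<in> {0<..T}. \<not> isCont (\<lambda>s. X s \<omega>) u}"
  have fin: "finite D" unfolding D_def using finitely_many_jumps[OF \<omega>] by simp
  have "(\<lambda>u. X u \<omega>) ` {0..T} \<subseteq> (\<lambda>u. X u \<omega>) ` D"
  proof safe
    fix u assume u: "u \<in> {0..T}"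
    define e where "e = Max {d \<in> D. d \<le> u}"
    have ne: "{d \<in> D. d \<le> u} \<noteq> {}" using u by (auto simp: D_def)
    have e: "e \<in> D" "e \<le> u" using Max_in[OF _ ne] fin unfolding e_def by auto
    have "X u \<omega> = X e \<omega>"
    proof (rule path_const[OF \<omega> _ e(2)])
      show "0 \<le> e" using e(1) by (auto simp: D_def)
      fix v assume v: "e < v" "v \<le> u"
      show "isCont (\<lambda>s. X s \<omega>) v"
      proof (rule ccontr)
        assume "\<not> ?thesis"
        then have "v \<in> {d \<in> D. d \<le> u}" using v u \<open>0 \<le> e\<close> by (auto simp: D_def)
        then have "v \<le> e" unfolding e_def using fin by auto
        then show False using v by simp
      qed
    qed
    then show "X u \<omega> \<in> (\<lambda>u. X u \<omega>) ` D" using e(1) by auto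
  qed
  then show ?thesis by (rule finite_surj[OF fin])
qed

text \<open>The infimum is attained: a visit to \<open>S\<close> shortly after the infimum falls
  into the stretch on which the path keeps its value at the infimum. All later pathwise arguments go
  through this case distinction.\<close>

lemma hitting_time_cases:
  assumes \<omega>: "\<omega> \<in> space M" and s: "0 \<le> s"
  obtains (never) "hitting_time X S s \<omega> = \<infinity>" "\<And>u. s \<le> u \<Longrightarrow> X u \<omega> \<notin> S"
  | (hit) t where "hitting_time X S s \<omega> = ereal t" "s \<le> t" "X t \<omega> \<in> S"
      "\<And>u. s \<le> u \<Longrightarrow> u < t \<Longrightarrow> X u \<omega> \<notin> S"
proof (cases "\<exists>u\<ge>s. X u \<omega> \<in> S")
  case False
  then have "{t. s \<le> t \<and> X t \<omega> \<in> S} = {}" by auto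
  then have "hitting_time X S s \<omega> = \<infinity>" by (simp only: hitting_time_def image_empty Inf_empty top_ereal_def)
  with False show ?thesis by (intro never) auto
next
  case True
  define U where "U = {t. s \<le> t \<and> X t \<omega> \<in> S}"
  define t where "t = Inf U"
  have bdd: "bdd_below U" and ne: "U \<noteq> {}" using True by (auto simp: U_def)
  have st: "s \<le> t" unfolding t_def using ne by (intro cInf_greatest) (auto simp: U_def)
  obtain \<eta> where \<eta>: "\<eta> > 0" "\<And>u. t \<le> u \<Longrightarrow> u < t + \<eta> \<Longrightarrow> X u \<omega> = X t \<omega>"
    using path_right_const[OF \<omega>] s st by (metis order_trans)
  obtain u where u: "u \<in> U" "u < t + \<eta>"
    using cInf_lessD[OF ne, of "t + \<eta>"] \<eta>(1) unfolding t_def by auto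
  have "t \<le> u" unfolding t_def by (intro cInf_lower u bdd)
  then have tS: "X t \<omega> \<in> S" using \<eta>(2)[of u] u by (auto simp: U_def)
  have "t \<le> v" if "v \<in> U" for v unfolding t_def by (intro cInf_lower that bdd)
  then have least: "\<And>v. s \<le> v \<Longrightarrow> v < t \<Longrightarrow> X v \<omega> \<notin> S" by (force simp: U_def)
  have "Inf (ereal ` U) = ereal t"
  proof (rule antisym)
    show "Inf (ereal ` U) \<le> ereal t" using st tS by (intro Inf_lower) (auto simp: U_def)
    show "ereal t \<le> Inf (ereal ` U)"
      using \<open>\<And>v. v \<in> U \<Longrightarrow> t \<le> v\<close> by (intro Inf_greatest) auto
  qed
  then show ?thesis using st tS least by (intro hit) (auto simp: hitting_time_def U_def)
qed

lemma measurable_X_count [measurable]: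
  assumes "0 \<le> t"
  shows "X t \<in> measurable M (count_space \<X>)"
  unfolding measurable_count_space_eq_countable[OF countable_states]
  using measurable_sets[OF measurable_X[OF assms], of "{_}"] X_in_states[OF assms] by auto

lemma borel_fun_X [measurable]:
  "0 \<le> t \<Longrightarrow> (\<lambda>\<omega>. f (X t \<omega>)) \<in> borel_measurable M"
  by (rule measurable_compose[OF measurable_X_count]) auto

lemma sets_X [measurable]:
  assumes "0 \<le> t"
  shows "{\<omega> \<in> space M. X t \<omega> \<in> S} \<in> sets M"
proof -
  have "{\<omega> \<in> space M. X t \<omega> \<in> S} = X t -` (S \<inter> \<X>) \<inter> space M"
    using X_in_states[OF assms] by auto
  then show ?thesis using measurable_sets[OF measurable_X_count[OF assms], of "S \<inter> \<X>"] by simp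
qed

lemma space_P: "x \<in> \<X> \<Longrightarrow> space (P x) = space M"
  by (rule sets_eq_imp_space_eq[OF sets_P])

lemma measurable_P: "x \<in> \<X> \<Longrightarrow> borel_measurable (P x) = (borel_measurable M :: ('w \<Rightarrow> 'b::topological_space) set)"
  by (rule measurable_cong_sets[OF sets_P refl])

subsection \<open>The Markov property\<close>

text \<open>The transition semigroup. With values in \<open>ennreal\<close>, series and integrals
  can be exchanged freely, and every function of the state is measurable because there are countably
  many states.\<close>

definition trans_op :: "real \<Rightarrow> (real \<Rightarrow> ennreal) \<Rightarrow> real \<Rightarrow> ennreal" where
  "trans_op t g x = (\<integral>\<^sup>+\<omega>. g (X t \<omega>) \<partial>P x)"

lemma history_sets:
  assumes "0 \<le> s" "A \<in> history M X s"
  shows "A \<in> sets M"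
proof -
  have "(\<Union>u\<in>{0..s}. {X u -` B \<inter> space M |B. B \<in> sets borel}) \<subseteq> sets M"
    using measurable_sets[OF measurable_X] by auto
  from sets.sigma_sets_subset[OF this] assms(2) show ?thesis by (auto simp: history_def)
qed

text \<open>Splitting by the value of \<open>X t\<close> turns an expectation into a sum over
  states, the form in which the assumption \<open>markov\<close> can be applied.\<close>

lemma nn_integral_X_decomp:
  assumes x: "x \<in> \<X>" and t: "0 \<le> t" and \<phi>: "\<phi> \<in> borel_measurable M"
  shows "(\<integral>\<^sup>+\<omega>. \<phi> \<omega> * g (X t \<omega>) \<partial>P x) =
    (\<integral>\<^sup>+y. g y * (\<integral>\<^sup>+\<omega>. \<phi> \<omega> * indicator {y} (X t \<omega>) \<partial>P x) \<partial>count_space \<X>)"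
proof -
  have ind: "(\<lambda>\<omega>. indicator {y} (X t \<omega>) :: ennreal) \<in> borel_measurable M" for y
    using borel_fun_X[OF t, of "indicator {y}"] .
  have "(\<integral>\<^sup>+\<omega>. \<phi> \<omega> * g (X t \<omega>) \<partial>P x) =
      (\<integral>\<^sup>+\<omega>. (\<integral>\<^sup>+y. g y * (\<phi> \<omega> * indicator {y} (X t \<omega>)) \<partial>count_space \<X>) \<partial>P x)"
  proof (rule nn_integral_cong)
    fix \<omega> assume "\<omega> \<in> space (P x)"
    then have X: "X t \<omega> \<in> \<X>" using X_in_states t by (simp add: space_P x)
    have "(\<integral>\<^sup>+y. g y * (\<phi> \<omega> * indicator {y} (X t \<omega>)) \<partial>count_space \<X>) =
        (\<integral>\<^sup>+y. (g y * \<phi> \<omega>) * indicator {X t \<omega>} y \<partial>count_space \<X>)"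
      by (intro nn_integral_cong) (auto simp: indicator_def)
    also have "\<dots> = g (X t \<omega>) * \<phi> \<omega>"
      using X by (subst nn_integral_indicator_singleton) auto
    finally show "\<phi> \<omega> * g (X t \<omega>) =
      (\<integral>\<^sup>+y. g y * (\<phi> \<omega> * indicator {y} (X t \<omega>)) \<partial>count_space \<X>)"
      by (simp add: mult.commute)
  qed
  also have "\<dots> = (\<integral>\<^sup>+y. (\<integral>\<^sup>+\<omega>. g y * (\<phi> \<omega> * indicator {y} (X t \<omega>)) \<partial>P x) \<partial>count_space \<X>)"
    using \<phi> ind
    by (intro nn_integral_count_space_nn_integral countable_states) (simp add: measurable_P x)
  also have "\<dots> = (\<integral>\<^sup>+y. g y * (\<integral>\<^sup>+\<omega>. \<phi> \<omega> * indicator {y} (X t \<omega>) \<partial>P x) \<partial>count_space \<X>)"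
    using \<phi> ind
    by (intro nn_integral_cong nn_integral_cmult) (simp add: measurable_P x)
  finally show ?thesis .
qed

lemma emeasure_P: "x \<in> \<X> \<Longrightarrow> emeasure (P x) A = ennreal (measure (P x) A)"
  by (simp add: finite_measure.emeasure_eq_measure prob_space.finite_measure prob_space_P)

lemma trans_op_eq:
  assumes x: "x \<in> \<X>" and t: "0 \<le> t"
  shows "trans_op t g x = (\<integral>\<^sup>+y. g y * ennreal (trans_prob M P X t x y) \<partial>count_space \<X>)"
proof -
  have "(\<integral>\<^sup>+\<omega>. 1 * indicator {y} (X t \<omega>) \<partial>P x) = ennreal (trans_prob M P X t x y)" for y
  proof -
    have "(\<integral>\<^sup>+\<omega>. 1 * indicator {y} (X t \<omega>) \<partial>P x) =
        (\<integral>\<^sup>+\<omega>. indicator {\<omega> \<in> space M. X t \<omega> = y} \<omega> \<partial>P x)"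
      by (intro nn_integral_cong) (auto simp: space_P x indicator_def)
    also have "\<dots> = emeasure (P x) {\<omega> \<in> space M. X t \<omega> = y}"
      using sets_X[OF t, of "{y}"] by (intro nn_integral_indicator) (simp add: sets_P x)
    finally show ?thesis by (simp add: emeasure_P x trans_prob_def)
  qed
  then show ?thesis
    using nn_integral_X_decomp[OF x t, of "\<lambda>_. 1" g] by (simp add: trans_op_def)
qed

text \<open>The assumption \<open>markov\<close> concerns single states \<open>z\<close> at time
  \<open>s\<close> and \<open>y\<close> at time \<open>s + t\<close>. Decomposing over both,
  exchanging the sums and reassembling extends it to arbitrary nonnegative functions of the later
  state.\<close>

lemma markov_trans_op:
  assumes x: "x \<in> \<X>" and s: "0 \<le> s" and t: "0 \<le> t" and A: "A \<in> history M X s"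
  shows "(\<integral>\<^sup>+\<omega>. indicator A \<omega> * g (X (s + t) \<omega>) \<partial>P x) =
    (\<integral>\<^sup>+\<omega>. indicator A \<omega> * trans_op t g (X s \<omega>) \<partial>P x)"
proof -
  have AM: "A \<in> sets M" by (rule history_sets[OF s A])
  have st: "0 \<le> s + t" using s t by simp
  have ind: "(indicator A :: 'w \<Rightarrow> ennreal) \<in> borel_measurable M" using AM by simp
  define m where "m z = (\<integral>\<^sup>+\<omega>. indicator A \<omega> * indicator {z} (X s \<omega>) \<partial>P x)" for z
  have setz: "{\<omega> \<in> A. X s \<omega> = z} \<in> sets M" for z
  proof -
    have "{\<omega> \<in> A. X s \<omega> = z} = A \<inter> {\<omega> \<in> space M. X s \<omega> \<in> {z}}"
      using sets.sets_into_space[OF AM] by auto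
    then show ?thesis using AM sets_X[OF s, of "{z}"] by auto
  qed
  have setzy: "{\<omega> \<in> A. X s \<omega> = z \<and> X (s + t) \<omega> = y} \<in> sets M" for y z
  proof -
    have "{\<omega> \<in> A. X s \<omega> = z \<and> X (s + t) \<omega> = y} =
        {\<omega> \<in> A. X s \<omega> = z} \<inter> {\<omega> \<in> space M. X (s + t) \<omega> \<in> {y}}"
      using sets.sets_into_space[OF AM] by auto
    then show ?thesis using setz sets_X[OF st, of "{y}"] by auto
  qed
  have m: "m z = ennreal (measure (P x) {\<omega> \<in> A. X s \<omega> = z})" for z
  proof -
    have "m z = (\<integral>\<^sup>+\<omega>. indicator {\<omega> \<in> A. X s \<omega> = z} \<omega> \<partial>P x)"
      unfolding m_def by (intro nn_integral_cong) (auto simp: indicator_def)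
    also have "\<dots> = emeasure (P x) {\<omega> \<in> A. X s \<omega> = z}"
      using setz by (intro nn_integral_indicator) (simp add: sets_P x)
    finally show ?thesis by (simp add: emeasure_P x)
  qed
  have inner: "(\<integral>\<^sup>+\<omega>. indicator A \<omega> * indicator {y} (X (s + t) \<omega>) \<partial>P x) =
      (\<integral>\<^sup>+z. m z * ennreal (trans_prob M P X t z y) \<partial>count_space \<X>)" if y: "y \<in> \<X>" for y
  proof -
    let ?\<phi> = "\<lambda>\<omega>. indicator A \<omega> * indicator {y} (X (s + t) \<omega>) :: ennreal"
    have "?\<phi> \<in> borel_measurable M"
      using ind borel_fun_X[OF st, of "\<lambda>v. indicator {y} v :: ennreal"] by simp
    from nn_integral_X_decomp[OF x s this, of "\<lambda>_. 1"]
    have "(\<integral>\<^sup>+\<omega>. ?\<phi> \<omega> \<partial>P x) =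
        (\<integral>\<^sup>+z. (\<integral>\<^sup>+\<omega>. ?\<phi> \<omega> * indicator {z} (X s \<omega>) \<partial>P x) \<partial>count_space \<X>)"
      by simp
    also have "\<dots> = (\<integral>\<^sup>+z. m z * ennreal (trans_prob M P X t z y) \<partial>count_space \<X>)"
    proof (rule nn_integral_cong)
      fix z assume "z \<in> space (count_space \<X>)"
      then have z: "z \<in> \<X>" by simp
      have "(\<integral>\<^sup>+\<omega>. ?\<phi> \<omega> * indicator {z} (X s \<omega>) \<partial>P x) =
          (\<integral>\<^sup>+\<omega>. indicator {\<omega> \<in> A. X s \<omega> = z \<and> X (s + t) \<omega> = y} \<omega> \<partial>P x)"
        by (intro nn_integral_cong) (auto simp: indicator_def)
      also have "\<dots> = emeasure (P x) {\<omega> \<in> A. X s \<omega> = z \<and> X (s + t) \<omega> = y}"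
        using setzy by (intro nn_integral_indicator) (simp add: sets_P x)
      also have "\<dots> = m z * ennreal (trans_prob M P X t z y)"
        by (simp add: emeasure_P x markov[OF x y z s t A] m ennreal_mult trans_prob_def)
      finally show "(\<integral>\<^sup>+\<omega>. ?\<phi> \<omega> * indicator {z} (X s \<omega>) \<partial>P x) =
        m z * ennreal (trans_prob M P X t z y)" .
    qed
    finally show ?thesis .
  qed
  have "(\<integral>\<^sup>+\<omega>. indicator A \<omega> * g (X (s + t) \<omega>) \<partial>P x) =
      (\<integral>\<^sup>+y. g y * (\<integral>\<^sup>+z. m z * ennreal (trans_prob M P X t z y) \<partial>count_space \<X>) \<partial>count_space \<X>)"
    by (subst nn_integral_X_decomp[OF x st ind], intro nn_integral_cong) (simp only: inner space_count_space)
  also have "\<dots> = (\<integral>\<^sup>+y. (\<integral>\<^sup>+z. g y * (m z * ennreal (trans_prob M P X t z y)) \<partial>count_space \<X>) \<partial>count_space \<X>)"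
    by (intro nn_integral_cong nn_integral_cmult[symmetric]) auto
  also have "\<dots> = (\<integral>\<^sup>+z. (\<integral>\<^sup>+y. g y * (m z * ennreal (trans_prob M P X t z y)) \<partial>count_space \<X>) \<partial>count_space \<X>)"
    by (intro nn_integral_count_space_nn_integral countable_states) auto
  also have "\<dots> = (\<integral>\<^sup>+z. (\<integral>\<^sup>+y. m z * (g y * ennreal (trans_prob M P X t z y)) \<partial>count_space \<X>) \<partial>count_space \<X>)"
    by (simp only: mult.left_commute)
  also have "\<dots> = (\<integral>\<^sup>+z. m z * trans_op t g z \<partial>count_space \<X>)"
    by (intro nn_integral_cong) (simp add: nn_integral_cmult trans_op_eq t)
  also have "\<dots> = (\<integral>\<^sup>+\<omega>. indicator A \<omega> * trans_op t g (X s \<omega>) \<partial>P x)"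
    by (subst nn_integral_X_decomp[OF x s ind]) (simp only: m_def mult.commute)
  finally show ?thesis .
qed

lemma nn_integral_start:
  assumes x: "x \<in> \<X>"
  shows "(\<integral>\<^sup>+\<omega>. g (X 0 \<omega>) \<partial>P x) = g x"
proof -
  interpret prob_space "P x" by (rule prob_space_P[OF x])
  have "prob {\<omega> \<in> space M. X 0 \<omega> = x} = 1" using start[OF x] by (simp add: trans_prob_def)
  moreover have "{\<omega> \<in> space M. X 0 \<omega> = x} \<in> events"
    using sets_X[of 0 "{x}"] by (simp add: sets_P x)
  ultimately have "AE \<omega> in P x. \<omega> \<in> {\<omega> \<in> space M. X 0 \<omega> = x}"
    by (simp only: AE_in_set_eq_1)
  then have "(\<integral>\<^sup>+\<omega>. g (X 0 \<omega>) \<partial>P x) = (\<integral>\<^sup>+\<omega>. g x \<partial>P x)"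
    by (intro nn_integral_cong_AE) auto
  then show ?thesis by (simp add: emeasure_space_1)
qed

subsection \<open>Stopping on a time grid\<close>

lemma trans_op_cong:
  assumes "x \<in> \<X>" "0 \<le> t" "\<And>y. y \<in> \<X> \<Longrightarrow> f y = g y"
  shows "trans_op t f x = trans_op t g x"
  unfolding trans_op_def using assms X_in_states by (intro nn_integral_cong) (auto simp: space_P)

lemma trans_op_mono:
  assumes "x \<in> \<X>" "0 \<le> t" "\<And>y. y \<in> \<X> \<Longrightarrow> f y \<le> g y"
  shows "trans_op t f x \<le> trans_op t g x"
  unfolding trans_op_def using assms X_in_states by (intro nn_integral_mono) (auto simp: space_P)

lemma trans_op_cmult: "x \<in> \<X> \<Longrightarrow> 0 \<le> t \<Longrightarrow> trans_op t (\<lambda>y. c * f y) x = c * trans_op t f x"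
  unfolding trans_op_def by (intro nn_integral_cmult) (simp only: measurable_P borel_fun_X)

lemma trans_op_sum:
  "x \<in> \<X> \<Longrightarrow> 0 \<le> t \<Longrightarrow> trans_op t (\<lambda>y. \<Sum>k\<in>K. f k y) x = (\<Sum>k\<in>K. trans_op t (f k) x)"
  unfolding trans_op_def by (intro nn_integral_sum) (simp only: measurable_P borel_fun_X)

lemma trans_op_suminf:
  "x \<in> \<X> \<Longrightarrow> 0 \<le> t \<Longrightarrow> trans_op t (\<lambda>y. \<Sum>k. f k y) x = (\<Sum>k. trans_op t (f k) x)"
  unfolding trans_op_def by (intro nn_integral_suminf) (simp only: measurable_P borel_fun_X)

text \<open>
  With \<open>N\<close> the first index \<open>k\<close> such that \<open>X (k * h) \<in> S\<close>, the value of \<open>hit_val h S f k x\<close> is the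
  expectation of \<open>f (X (N * h))\<close> on the event \<open>N = k\<close> for the chain started at \<open>x\<close>.
\<close>

primrec hit_val :: "real \<Rightarrow> real set \<Rightarrow> (real \<Rightarrow> ennreal) \<Rightarrow> nat \<Rightarrow> real \<Rightarrow> ennreal" where
  "hit_val h S f 0 = (\<lambda>x. if x \<in> S then f x else 0)"
| "hit_val h S f (Suc k) = (\<lambda>x. if x \<in> S then 0 else trans_op h (hit_val h S f k) x)"

text \<open>The counterpart of \<open>J\<close> when stopping is allowed at multiples of
  \<open>h\<close> only. The reward \<open>f\<close> is arbitrary so that one value can serve as the
  reward of another.\<close>

definition grid_val :: "real \<Rightarrow> (real \<Rightarrow> real) \<Rightarrow> real set \<Rightarrow> (real \<Rightarrow> ennreal) \<Rightarrow> real \<Rightarrow> ennreal" where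
  "grid_val h d S f x = (\<Sum>k. ennreal (d (real k * h)) * hit_val h S f k x)"

text \<open>As \<open>A \<subseteq> S\<close>, the first grid visit to \<open>A\<close> comes no
  earlier than the first one to \<open>S\<close>. The sum runs over the index \<open>k\<close> of
  the latter, after which \<open>m - k\<close> steps remain. The induction is first-step
  analysis.\<close>

lemma hit_val_decomp:
  assumes "A \<subseteq> S" "0 \<le> h" "x \<in> \<X>"
  shows "(\<Sum>k\<le>m. hit_val h S (hit_val h A f (m - k)) k x) = hit_val h A f m x"
  using assms(3)
proof (induction m arbitrary: x)
  case 0
  then show ?case using assms(1) by auto
next
  case (Suc m)
  have split: "(\<Sum>k\<le>Suc m. hit_val h S (hit_val h A f (Suc m - k)) k x) =
      hit_val h S (hit_val h A f (Suc m)) 0 x + (\<Sum>k\<le>m. hit_val h S (hit_val h A f (m - k)) (Suc k) x)"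
    by (subst sum.atMost_Suc_shift) simp
  show ?case
  proof (cases "x \<in> S")
    case True
    then show ?thesis unfolding split by simp
  next
    case False
    then have "(\<Sum>k\<le>m. hit_val h S (hit_val h A f (m - k)) (Suc k) x) =
        trans_op h (\<lambda>y. \<Sum>k\<le>m. hit_val h S (hit_val h A f (m - k)) k y) x"
      using Suc.prems assms(2) by (simp add: trans_op_sum)
    also have "\<dots> = trans_op h (hit_val h A f m) x"
      by (intro trans_op_cong Suc.prems assms(2) Suc.IH)
    finally show ?thesis using False assms(1) unfolding split by auto
  qed
qed

text \<open>\<open>hit_val\<close> is built from \<open>trans_op\<close>, hence linear in its reward
  even for countable sums.\<close>

lemma hit_val_grid_val:
  assumes "0 \<le> h" "x \<in> \<X>"
  shows "hit_val h S (grid_val h d A f) k x =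
    (\<Sum>j. ennreal (d (real j * h)) * hit_val h S (hit_val h A f j) k x)"
  using assms(2)
proof (induction k arbitrary: x)
  case 0
  then show ?case by (simp add: grid_val_def)
next
  case (Suc k)
  have "trans_op h (hit_val h S (grid_val h d A f) k) x =
      trans_op h (\<lambda>y. \<Sum>j. ennreal (d (real j * h)) * hit_val h S (hit_val h A f j) k y) x"
    by (intro trans_op_cong Suc.prems assms(1) Suc.IH)
  also have "\<dots> = (\<Sum>j. ennreal (d (real j * h)) * trans_op h (hit_val h S (hit_val h A f j) k) x)"
    using Suc.prems assms(1) by (simp add: trans_op_suminf trans_op_cmult)
  finally show ?case by simp
qed

text \<open>Going first to \<open>S\<close> and then to \<open>A\<close> collects the discount in
  two factors, whose product is at most the discount of the total time. Regrouping by the total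
  index and \<open>hit_val_decomp\<close> give back the value of \<open>A\<close>.\<close>

lemma grid_val_le:
  assumes AS: "A \<subseteq> S" and h: "0 \<le> h" and x: "x \<in> \<X>"
    and d0: "\<And>t. 0 \<le> t \<Longrightarrow> 0 \<le> d t"
    and d: "\<And>s t. 0 \<le> s \<Longrightarrow> 0 \<le> t \<Longrightarrow> d s * d t \<le> d (s + t)"
  shows "grid_val h d S (grid_val h d A f) x \<le> grid_val h d A f x"
proof -
  let ?b = "\<lambda>k j. hit_val h S (hit_val h A f j) k x"
  have "grid_val h d S (grid_val h d A f) x =
      (\<Sum>k. \<Sum>j. ennreal (d (real k * h)) * (ennreal (d (real j * h)) * ?b k j))"
    unfolding grid_val_def[of h d S]
    by (simp only: hit_val_grid_val[OF h x] ennreal_suminf_cmult)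
  also have "\<dots> \<le> (\<Sum>k. \<Sum>j. ennreal (d (real (k + j) * h)) * ?b k j)"
  proof (intro suminf_le allI summableI)
    fix k j
    have "ennreal (d (real k * h)) * ennreal (d (real j * h)) \<le> ennreal (d (real (k + j) * h))"
      using d[of "real k * h" "real j * h"] d0 h
      by (simp add: ennreal_mult[symmetric] distrib_right ennreal_leI)
    then show "ennreal (d (real k * h)) * (ennreal (d (real j * h)) * ?b k j)
        \<le> ennreal (d (real (k + j) * h)) * ?b k j"
      unfolding mult.assoc[symmetric] by (rule mult_right_mono) simp
  qed
  also have "\<dots> \<le> (\<Sum>m. \<Sum>k\<le>m. ennreal (d (real (k + (m - k)) * h)) * ?b k (m - k))"
    by (rule suminf_ennreal_diagonal_le)
  also have "\<dots> = (\<Sum>m. \<Sum>k\<le>m. ennreal (d (real m * h)) * ?b k (m - k))"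
    by (intro suminf_cong sum.cong) auto
  also have "\<dots> = grid_val h d A f x"
    unfolding grid_val_def
    by (simp only: sum_distrib_left[symmetric] hit_val_decomp[OF AS h x])
  finally show ?thesis .
qed

definition grid_free :: "real \<Rightarrow> real \<Rightarrow> real set \<Rightarrow> nat \<Rightarrow> 'w set" where
  "grid_free s h S k = {\<omega> \<in> space M. \<forall>j<k. X (s + real j * h) \<omega> \<notin> S}"

text \<open>The pathwise counterpart of \<open>grid_val\<close>, with the grid starting at
  \<open>s\<close>. At most one summand is nonzero, that of the first grid time in \<open>S\<close>;
  the series form allows integration term by term.\<close>

definition grid_payoff ::
    "real \<Rightarrow> real \<Rightarrow> (real \<Rightarrow> real) \<Rightarrow> real set \<Rightarrow> (real \<Rightarrow> ennreal) \<Rightarrow> 'w \<Rightarrow> ennreal" where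
  "grid_payoff s h d S f \<omega> = (\<Sum>k. ennreal (d (s + real k * h)) *
     (indicator (grid_free s h S k) \<omega> * hit_val h S f 0 (X (s + real k * h) \<omega>)))"

lemma grid_free_history:
  assumes s: "0 \<le> s" and h: "0 \<le> h" and kt: "\<And>j. j < k \<Longrightarrow> s + real j * h \<le> t"
  shows "grid_free s h S k \<in> history M X t"
  using kt
proof (induction k)
  case 0
  have "space M \<in> history M X t" unfolding history_def by (rule sigma_sets_top)
  then show ?case by (simp add: grid_free_def)
next
  case (Suc k)
  let ?G = "\<Union>u\<in>{0..t}. {X u -` B \<inter> space M |B. B \<in> sets borel}"
  interpret H: sigma_algebra "space M" "history M X t"
    unfolding history_def by (rule sigma_algebra_sigma_sets) auto
  define u where "u = s + real k * h"
  have u: "u \<in> {0..t}" using Suc.prems[of k] s h by (auto simp: u_def)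
  \<comment> \<open>\<open>S\<close> is an arbitrary set of reals, but its trace on the countable
    state space is Borel.\<close>
  have count: "countable (S \<inter> \<X>)" by (rule countable_subset[OF _ countable_states]) simp
  have "S \<inter> \<X> \<in> sets borel" by (rule sets.countable[OF _ count]) simp
  then have "- (S \<inter> \<X>) \<in> sets borel" by (rule borel_comp)
  then have "X u -` (- (S \<inter> \<X>)) \<inter> space M \<in> ?G" using u by blast
  then have "X u -` (- (S \<inter> \<X>)) \<inter> space M \<in> history M X t"
    unfolding history_def by (rule sigma_sets.Basic)
  moreover have "grid_free s h S k \<in> history M X t" using Suc by simp
  moreover have "grid_free s h S (Suc k) = grid_free s h S k \<inter> (X u -` (- (S \<inter> \<X>)) \<inter> space M)"
    using X_in_states u by (auto simp: grid_free_def u_def less_Suc_eq)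
  ultimately show ?case by auto
qed

lemma grid_free_sets:
  assumes "0 \<le> s" "0 \<le> h"
  shows "grid_free s h S k \<in> sets M"
proof (rule history_sets)
  show "grid_free s h S k \<in> history M X (s + real k * h)"
    using assms by (intro grid_free_history add_left_mono mult_right_mono) auto
  show "0 \<le> s + real k * h" using assms by simp
qed

text \<open>The Markov property at time \<open>s + k * h\<close> trades the last grid step of the
  path for one application of \<open>trans_op h\<close>; the condition at that time in
  \<open>grid_free\<close> becomes the case distinction of \<open>hit_val\<close> at
  \<open>Suc i\<close>.\<close>

lemma grid_markov:
  assumes s: "0 \<le> s" and h: "0 \<le> h" and x: "x \<in> \<X>"
  shows "(\<integral>\<^sup>+\<omega>. indicator (grid_free s h S k) \<omega> * hit_val h S f i (X (s + real k * h) \<omega>) \<partial>P x) =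
    (\<integral>\<^sup>+\<omega>. hit_val h S f (k + i) (X s \<omega>) \<partial>P x)"
proof (induction k arbitrary: i)
  case 0
  show ?case by (intro nn_integral_cong) (simp add: grid_free_def space_P x)
next
  case (Suc k)
  have skh: "s + real (Suc k) * h = (s + real k * h) + h" by (simp add: algebra_simps)
  have hist: "grid_free s h S (Suc k) \<in> history M X (s + real k * h)"
    using s h by (intro grid_free_history add_left_mono mult_right_mono) auto
  have "(\<integral>\<^sup>+\<omega>. indicator (grid_free s h S (Suc k)) \<omega> * hit_val h S f i (X (s + real (Suc k) * h) \<omega>) \<partial>P x) =
      (\<integral>\<^sup>+\<omega>. indicator (grid_free s h S (Suc k)) \<omega> * trans_op h (hit_val h S f i) (X (s + real k * h) \<omega>) \<partial>P x)"
    unfolding skh using s h by (intro markov_trans_op[OF x _ h hist]) simp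
  also have "\<dots> = (\<integral>\<^sup>+\<omega>. indicator (grid_free s h S k) \<omega> * hit_val h S f (Suc i) (X (s + real k * h) \<omega>) \<partial>P x)"
    by (intro nn_integral_cong) (auto simp: grid_free_def indicator_def less_Suc_eq)
  finally show ?case by (simp only: Suc.IH add_Suc_shift)
qed

lemma grid_payoff_measurable:
  assumes "0 \<le> s" "0 \<le> h"
  shows "grid_payoff s h d S f \<in> borel_measurable M"
proof -
  have "(\<lambda>\<omega>. ennreal (d (s + real k * h)) *
     (indicator (grid_free s h S k) \<omega> * hit_val h S f 0 (X (s + real k * h) \<omega>))) \<in> borel_measurable M" for k
    using grid_free_sets[OF assms] assms
    by (intro borel_measurable_times_ennreal borel_measurable_indicator borel_fun_X) auto
  then show ?thesis unfolding grid_payoff_def[abs_def] by (intro borel_measurable_suminf_order)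
qed

lemma nn_integral_grid_payoff:
  assumes s: "0 \<le> s" and h: "0 \<le> h" and x: "x \<in> \<X>"
  shows "(\<integral>\<^sup>+\<omega>. grid_payoff s h d S f \<omega> \<partial>P x) =
    (\<Sum>k. ennreal (d (s + real k * h)) * (\<integral>\<^sup>+\<omega>. hit_val h S f k (X s \<omega>) \<partial>P x))"
proof -
  let ?g = "\<lambda>k \<omega>. indicator (grid_free s h S k) \<omega> * hit_val h S f 0 (X (s + real k * h) \<omega>)"
  have m: "?g k \<in> borel_measurable (P x)" for k
    unfolding measurable_P[OF x] using grid_free_sets[OF s h] s h
    by (intro borel_measurable_times_ennreal borel_measurable_indicator borel_fun_X) auto
  have "(\<integral>\<^sup>+\<omega>. grid_payoff s h d S f \<omega> \<partial>P x) =
      (\<Sum>k. ennreal (d (s + real k * h)) * (\<integral>\<^sup>+\<omega>. ?g k \<omega> \<partial>P x))"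
    unfolding grid_payoff_def
    using m by (subst nn_integral_suminf) (auto simp: nn_integral_cmult simp del: hit_val.simps)
  also have "(\<lambda>k. \<integral>\<^sup>+\<omega>. ?g k \<omega> \<partial>P x) = (\<lambda>k. \<integral>\<^sup>+\<omega>. hit_val h S f k (X s \<omega>) \<partial>P x)"
    using grid_markov[OF s h x, of S _ f 0] by (simp only: add_0_right)
  finally show ?thesis .
qed

lemma nn_integral_grid_payoff_start:
  assumes "0 \<le> h" "x \<in> \<X>"
  shows "(\<integral>\<^sup>+\<omega>. grid_payoff 0 h d S f \<omega> \<partial>P x) = grid_val h d S f x"
  using assms by (simp add: nn_integral_grid_payoff nn_integral_start grid_val_def)

subsection \<open>Refining the grid\<close>

text \<open>An \<open>ennreal\<close> version of \<open>stopped_payoff\<close> with a general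
  reward; the payoff in \<open>J_from\<close> is the case \<open>f = ennreal\<close>.\<close>

definition payoff :: "real \<Rightarrow> (real \<Rightarrow> real) \<Rightarrow> real set \<Rightarrow> (real \<Rightarrow> ennreal) \<Rightarrow> 'w \<Rightarrow> ennreal" where
  "payoff s d S f \<omega> = (if hitting_time X S s \<omega> = \<infinity> then 0
     else ennreal (d (real_of_ereal (hitting_time X S s \<omega>))) * f (X (real_of_ereal (hitting_time X S s \<omega>)) \<omega>))"

lemma payoff_never: "hitting_time X S s \<omega> = \<infinity> \<Longrightarrow> payoff s d S f \<omega> = 0"
  by (simp add: payoff_def)

lemma payoff_hit: "hitting_time X S s \<omega> = ereal t \<Longrightarrow> payoff s d S f \<omega> = ennreal (d t) * f (X t \<omega>)"
  by (simp add: payoff_def)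

lemma grid_payoff_never:
  assumes "\<And>u. s \<le> u \<Longrightarrow> X u \<omega> \<notin> S" "0 \<le> h"
  shows "grid_payoff s h d S f \<omega> = 0"
  using assms by (simp add: grid_payoff_def)

lemma grid_payoff_hit:
  assumes \<omega>: "\<omega> \<in> space M" and h: "0 < h"
    and free: "\<And>j. j < k \<Longrightarrow> X (s + real j * h) \<omega> \<notin> S"
    and hit: "X (s + real k * h) \<omega> \<in> S"
  shows "grid_payoff s h d S f \<omega> = ennreal (d (s + real k * h)) * f (X (s + real k * h) \<omega>)"
proof -
  have "ennreal (d (s + real j * h)) *
     (indicator (grid_free s h S j) \<omega> * hit_val h S f 0 (X (s + real j * h) \<omega>)) = 0" if "j \<noteq> k" for j
  proof (cases "j < k")
    case True
    then show ?thesis using free by simp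
  next
    case False
    then have "k < j" using that by simp
    then have "\<omega> \<notin> grid_free s h S j" using hit by (auto simp: grid_free_def)
    then show ?thesis by simp
  qed
  then have "grid_payoff s h d S f \<omega> = ennreal (d (s + real k * h)) *
     (indicator (grid_free s h S k) \<omega> * hit_val h S f 0 (X (s + real k * h) \<omega>))"
    unfolding grid_payoff_def by (subst suminf_finite[of "{k}"]) auto
  then show ?thesis using \<omega> free hit by (simp add: grid_free_def)
qed

text \<open>With the reciprocals of integers as mesh sizes, every natural number is a point of every
  grid that starts at 0.\<close>

definition step :: "nat \<Rightarrow> real" where
  "step n = inverse (real (Suc n))"

lemma step_pos: "0 < step n"
  by (simp add: step_def)

lemma step_tendsto: "step \<longlonglongrightarrow> 0"
  unfolding step_def[abs_def] by (rule LIMSEQ_inverse_real_of_nat)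

text \<open>The first grid time at or after the hitting time is less than one step late, and on a
  fine grid the path has not moved meanwhile. So only the discount factor and the reward change with
  \<open>n\<close>, and both converge.\<close>

lemma grid_payoff_tendsto:
  assumes \<omega>: "\<omega> \<in> space M" and s: "0 \<le> s"
    and f: "\<And>y. y \<in> \<X> \<Longrightarrow> (\<lambda>n. f n y) \<longlonglongrightarrow> g y" and g: "\<And>y. y \<in> \<X> \<Longrightarrow> g y \<noteq> \<top>"
    and cont: "\<And>t. s < t \<Longrightarrow> hitting_time X S s \<omega> = ereal t \<Longrightarrow> isCont d t"
  shows "(\<lambda>n. grid_payoff s (step n) d S (f n) \<omega>) \<longlonglongrightarrow> payoff s d S g \<omega>"
  using \<omega> s
proof (cases rule: hitting_time_cases[where S = S])
  case never
  have "(\<lambda>n. grid_payoff s (step n) d S (f n) \<omega>) = (\<lambda>n. 0)"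
    using never(2) step_pos by (intro ext grid_payoff_never) (auto simp: less_imp_le)
  then show ?thesis by (simp add: payoff_never never(1))
next
  case (hit t)
  obtain \<eta> where \<eta>: "\<eta> > 0" "\<And>u. t \<le> u \<Longrightarrow> u < t + \<eta> \<Longrightarrow> X u \<omega> = X t \<omega>"
    using path_right_const[OF \<omega>] s hit(2) by (metis order_trans)
  have tX: "X t \<omega> \<in> \<X>" using X_in_states[OF _ \<omega>] s hit(2) by simp
  \<comment> \<open>The index of the first grid time that is not before \<open>t\<close>.\<close>
  define k where "k n = nat \<lceil>(t - s) / step n\<rceil>" for n
  define u where "u n = s + real (k n) * step n" for n
  have kn: "real (k n) = of_int \<lceil>(t - s) / step n\<rceil>" for n
    using hit(2) step_pos[of n] by (simp add: k_def)
  have ut: "t \<le> u n" for n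
  proof -
    have "(t - s) / step n \<le> real (k n)" unfolding kn by (rule le_of_int_ceiling)
    then show ?thesis using step_pos[of n] by (simp add: u_def field_simps)
  qed
  have ut': "u n < t + step n" for n
  proof -
    have "real (k n) < (t - s) / step n + 1" unfolding kn by linarith
    then have "real (k n) * step n < ((t - s) / step n + 1) * step n"
      using step_pos[of n] by (rule mult_strict_right_mono)
    also have "\<dots> = t - s + step n" using step_pos[of n] by (simp add: distrib_right)
    finally show ?thesis by (simp add: u_def)
  qed
  have before: "s + real j * step n < t" if "j < k n" for j n
  proof -
    have "real j < (t - s) / step n"
      using that step_pos[of n] unfolding k_def by linarith
    then show ?thesis using step_pos[of n] by (simp add: field_simps)
  qed
  have u_lim: "u \<longlonglongrightarrow> t"
  proof (rule tendsto_sandwich[of "\<lambda>_. t" u sequentially "\<lambda>n. t + step n"])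
    show "(\<lambda>n. t + step n) \<longlonglongrightarrow> t" using tendsto_add[OF tendsto_const step_tendsto] by simp
  qed (use ut ut' in \<open>auto intro!: always_eventually less_imp_le\<close>)
  have ev: "\<forall>\<^sub>F n in sequentially. grid_payoff s (step n) d S (f n) \<omega> = ennreal (d (u n)) * f n (X t \<omega>)"
    using order_tendstoD(2)[OF step_tendsto \<eta>(1)]
  proof eventually_elim
    case (elim n)
    have Xu: "X (u n) \<omega> = X t \<omega>" using ut[of n] ut'[of n] elim by (intro \<eta>(2)) auto
    have "grid_payoff s (step n) d S (f n) \<omega> =
        ennreal (d (s + real (k n) * step n)) * f n (X (s + real (k n) * step n) \<omega>)"
    proof (rule grid_payoff_hit[OF \<omega> step_pos])
      show "X (s + real j * step n) \<omega> \<notin> S" if "j < k n" for j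
        using before[OF that] step_pos[of n] by (intro hit(4)) auto
      show "X (s + real (k n) * step n) \<omega> \<in> S" using Xu hit(3) by (simp add: u_def)
    qed
    then show ?case using Xu by (simp add: u_def)
  qed
  have "(\<lambda>n. d (u n)) \<longlonglongrightarrow> d t"
  proof (cases "s < t")
    case True
    show ?thesis by (rule isCont_tendsto_compose[OF cont[OF True hit(1)] u_lim])
  next
    case False
    \<comment> \<open>Here \<open>t = s\<close> is the grid point of index 0, so the discount factor
      is constant in \<open>n\<close>.\<close>
    then have "u n = t" for n using hit(2) by (simp add: u_def k_def)
    then show ?thesis by simp
  qed
  then have "(\<lambda>n. ennreal (d (u n)) * f n (X t \<omega>)) \<longlonglongrightarrow> ennreal (d t) * g (X t \<omega>)"
    by (intro tendsto_mult_ennreal tendsto_ennrealI f tX) (use g[OF tX] in auto)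
  then show ?thesis
    unfolding payoff_hit[OF hit(1)] by (rule Lim_transform_eventually) (use ev in \<open>simp add: eq_commute\<close>)
qed

text \<open>Limits of grid payoffs settle continuous discounting, in particular by
  \<open>exp (- t)\<close> and by 1. A decreasing \<open>d\<close> is a Borel function and is
  composed with the hitting time.\<close>

lemma payoff_measurable:
  assumes s: "0 \<le> s" and d: "antimono_on {0..} d" and f: "\<And>y. y \<in> \<X> \<Longrightarrow> f y \<noteq> \<top>"
  shows "payoff s d S f \<in> borel_measurable M"
proof -
  have cont: "payoff s d' S f \<in> borel_measurable M"
    if "\<And>t. isCont d' t" "\<And>y. y \<in> \<X> \<Longrightarrow> f y \<noteq> \<top>" for d' f
  proof (rule borel_measurable_LIMSEQ_order)
    show "grid_payoff s (step n) d' S f \<in> borel_measurable M" for n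
      using s step_pos by (intro grid_payoff_measurable) (auto simp: less_imp_le)
    show "(\<lambda>n. grid_payoff s (step n) d' S f \<omega>) \<longlonglongrightarrow> payoff s d' S f \<omega>" if "\<omega> \<in> space M" for \<omega>
      using that s \<open>\<And>t. isCont d' t\<close> \<open>\<And>y. y \<in> \<X> \<Longrightarrow> f y \<noteq> \<top>\<close> by (intro grid_payoff_tendsto) auto
  qed
  define e where "e = payoff s (\<lambda>t. exp (- t)) S (\<lambda>_. 1)"
  have e: "e \<in> borel_measurable M" unfolding e_def by (intro cont) auto
  have p: "payoff s (\<lambda>_. 1) S f \<in> borel_measurable M" by (intro cont f) auto
  have "mono (\<lambda>t. - d (max 0 t))"
    using d by (intro monoI) (auto simp: monotone_on_def)
  then have "(\<lambda>t. - (- d (max 0 t))) \<in> borel_measurable borel"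
    by (intro borel_measurable_uminus borel_measurable_mono)
  then have dm: "(\<lambda>t. d (max 0 t)) \<in> borel_measurable borel" by simp
  \<comment> \<open>The hitting time is recovered from \<open>e = exp (- \<tau>)\<close>.\<close>
  have "payoff s d S f \<omega> =
      ennreal (d (max 0 (- ln (enn2real (e \<omega>))))) * payoff s (\<lambda>_. 1) S f \<omega>" if "\<omega> \<in> space M" for \<omega>
    using that s
  proof (cases rule: hitting_time_cases[where S = S])
    case never
    \<comment> \<open>Both payoffs vanish here, whatever the value of \<open>ln 0\<close>.\<close>
    then show ?thesis by (simp add: payoff_never)
  next
    case (hit t)
    then show ?thesis using s by (simp add: payoff_hit e_def max_def)
  qed
  moreover have "(\<lambda>\<omega>. ennreal (d (max 0 (- ln (enn2real (e \<omega>))))) * payoff s (\<lambda>_. 1) S f \<omega>) \<in> borel_measurable M"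
  proof -
    have "(\<lambda>\<omega>. - ln (enn2real (e \<omega>))) \<in> borel_measurable M" using e by measurable
    from measurable_compose[OF this dm] p show ?thesis
      by (intro borel_measurable_times_ennreal measurable_compose[OF _ measurable_ennreal])
  qed
  ultimately show ?thesis by (simp cong: measurable_cong)
qed

subsection \<open>Holding probabilities\<close>

text \<open>One way of being in \<open>x\<close> at time \<open>s + t\<close> is to be there at time
  \<open>s\<close> as well.\<close>

lemma trans_prob_mult_le:
  assumes x: "x \<in> \<X>" and s: "0 \<le> s" and t: "0 \<le> t"
  shows "trans_prob M P X s x x * trans_prob M P X t x x \<le> trans_prob M P X (s + t) x x"
proof -
  interpret prob_space "P x" by (rule prob_space_P[OF x])
  have "space M \<in> history M X s" unfolding history_def by (rule sigma_sets_top)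
  from markov[OF x x x s t this]
  have "trans_prob M P X s x x * trans_prob M P X t x x =
      prob {\<omega> \<in> space M. X s \<omega> = x \<and> X (s + t) \<omega> = x}" by (simp add: trans_prob_def)
  also have "\<dots> \<le> prob {\<omega> \<in> space M. X (s + t) \<omega> = x}"
    using sets_X[of "s + t" "{x}"] s t by (intro finite_measure_mono) (auto simp: sets_P x)
  finally show ?thesis by (simp add: trans_prob_def)
qed

text \<open>Cutting the interval into \<open>n\<close> pieces bounds the probability from below by
  \<open>(1 - c * t / n) ^ n\<close>, because the derivative at 0 exceeds \<open>- c\<close>. The
  limit in \<open>n\<close> is the exponential.\<close>

lemma trans_prob_stay_ge:
  assumes x: "x \<in> \<X>" and c: "\<Lambda> x < c" and t: "0 \<le> t"
  shows "exp (- c * t) \<le> trans_prob M P X t x x"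
proof (cases "t = 0")
  case True
  then show ?thesis using start[OF x] by simp
next
  case False
  then have t: "0 < t" using t by simp
  let ?p = "\<lambda>u. trans_prob M P X u x x"
  have "((\<lambda>u. (?p u - ?p 0) / (u - 0)) \<longlongrightarrow> - \<Lambda> x) (at_right 0)"
    using total_rate[OF x] unfolding has_field_derivative_iff at_within_Ici_at_right .
  from order_tendstoD(1)[OF this, of "- c"] c
  obtain b where b: "b > 0" "\<And>u. 0 < u \<Longrightarrow> u < b \<Longrightarrow> - c < (?p u - 1) / u"
    using start[OF x] unfolding eventually_at_right_field by auto
  have pow: "?p u ^ n \<le> ?p (real n * u)" if u: "0 \<le> u" for u n
  proof (induction n)
    case 0
    then show ?case using start[OF x] by simp
  next
    case (Suc n)
    have "?p u ^ Suc n \<le> ?p u * ?p (real n * u)"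
      using Suc by (simp add: mult_left_mono trans_prob_def)
    also have "\<dots> \<le> ?p (u + real n * u)" by (rule trans_prob_mult_le[OF x]) (use u in auto)
    finally show ?case by (simp add: algebra_simps)
  qed
  have "(\<lambda>n. (1 + (- c * t) / real n) ^ n) \<longlonglongrightarrow> exp (- c * t)"
    by (rule tendsto_exp_limit_sequentially)
  moreover have "\<forall>\<^sub>F n in sequentially. (1 + (- c * t) / real n) ^ n \<le> ?p t"
  proof -
    \<comment> \<open>The first bound puts \<open>t / n\<close> into the range of the derivative
      estimate; the second makes \<open>1 - c * t / n\<close> nonnegative, so that taking powers is
      monotone.\<close>
    obtain N where N: "max (t / b) (\<bar>c\<bar> * t) < real N" using reals_Archimedean2 by blast
    show ?thesis
      using eventually_ge_at_top[of N]
    proof eventually_elim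
      case (elim n)
      have n: "t / b < real n" "\<bar>c\<bar> * t < real n" using N elim by auto
      have n0: "0 < real n" using n(1) t b(1) by (meson divide_pos_pos order_less_trans)
      define u where "u = t / real n"
      have u: "0 < u" "u < b" using t n0 n(1) b(1) by (auto simp: u_def field_simps)
      have "0 \<le> 1 + (- c * u)"
      proof -
        have "c * t \<le> \<bar>c\<bar> * t" using t by (intro mult_right_mono) auto
        then have "c * t / real n \<le> 1" using n(2) n0 by (simp add: field_simps)
        then show ?thesis by (simp add: u_def)
      qed
      moreover have "1 + (- c * u) \<le> ?p u" using b(2)[OF u] u(1) by (simp add: field_simps)
      ultimately have "(1 + (- c * u)) ^ n \<le> ?p u ^ n" by (intro power_mono)
      also have "\<dots> \<le> ?p (real n * u)" using u by (intro pow) simp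
      finally show ?case using n0 by (simp add: u_def)
    qed
  qed
  ultimately show ?thesis by (intro tendsto_upperbound) auto
qed

text \<open>Summing over the state at time \<open>s\<close>, each state is occupied again at time
  \<open>s + t\<close> with probability at least \<open>exp (- c * t)\<close>, uniformly because
  \<open>c\<close> bounds all rates.\<close>

lemma prob_same_state_ge:
  assumes x: "x \<in> \<X>" and s: "0 \<le> s" and t: "0 \<le> t" and c: "\<And>y. y \<in> \<X> \<Longrightarrow> \<Lambda> y < c"
  shows "exp (- c * t) \<le> measure (P x) {\<omega> \<in> space M. X s \<omega> = X (s + t) \<omega>}"
proof -
  interpret prob_space "P x" by (rule prob_space_P[OF x])
  define E where "E z = {\<omega> \<in> space M. X s \<omega> = z \<and> X (s + t) \<omega> = z}" for z
  define F where "F z = {\<omega> \<in> space M. X s \<omega> = z}" for z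
  have st: "0 \<le> s + t" using s t by simp
  have Fs: "F z \<in> events" for z using sets_X[OF s, of "{z}"] by (simp add: F_def sets_P x)
  have Es: "E z \<in> events" for z
  proof -
    have "E z = F z \<inter> {\<omega> \<in> space M. X (s + t) \<omega> = z}" by (auto simp: E_def F_def)
    then show ?thesis using Fs[of z] sets_X[OF st, of "{z}"] by (simp add: sets_P x)
  qed
  have "ennreal (exp (- c * t)) = ennreal (exp (- c * t)) * emeasure (P x) (\<Union>z\<in>\<X>. F z)"
  proof -
    have "(\<Union>z\<in>\<X>. F z) = space (P x)" using X_in_states[OF s] by (auto simp: F_def space_P x)
    then show ?thesis by (simp add: emeasure_space_1)
  qed
  also have "emeasure (P x) (\<Union>z\<in>\<X>. F z) = (\<integral>\<^sup>+z. emeasure (P x) (F z) \<partial>count_space \<X>)"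
    using Fs countable_states by (intro emeasure_UN_countable) (auto simp: disjoint_family_on_def F_def)
  also have "ennreal (exp (- c * t)) * \<dots> = (\<integral>\<^sup>+z. ennreal (exp (- c * t)) * emeasure (P x) (F z) \<partial>count_space \<X>)"
    by (intro nn_integral_cmult[symmetric]) simp
  also have "\<dots> \<le> (\<integral>\<^sup>+z. emeasure (P x) (E z) \<partial>count_space \<X>)"
  proof (rule nn_integral_mono)
    fix z assume "z \<in> space (count_space \<X>)"
    then have z: "z \<in> \<X>" by simp
    have "space M \<in> history M X s" unfolding history_def by (rule sigma_sets_top)
    from markov[OF x z z s t this] have "prob (E z) = prob (F z) * trans_prob M P X t z z"
      by (simp add: E_def F_def)
    then have "exp (- c * t) * prob (F z) \<le> prob (E z)"
      using trans_prob_stay_ge[OF z c[OF z] t] by (simp add: mult.commute mult_left_mono)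
    then show "ennreal (exp (- c * t)) * emeasure (P x) (F z) \<le> emeasure (P x) (E z)"
      by (simp add: emeasure_eq_measure ennreal_mult[symmetric] ennreal_leI)
  qed
  also have "\<dots> = emeasure (P x) (\<Union>z\<in>\<X>. E z)"
    using Es countable_states by (intro emeasure_UN_countable[symmetric]) (auto simp: disjoint_family_on_def E_def)
  also have "(\<Union>z\<in>\<X>. E z) = {\<omega> \<in> space M. X s \<omega> = X (s + t) \<omega>}"
    using X_in_states[OF st] by (auto simp: E_def)
  finally show ?thesis by (simp add: emeasure_eq_measure)
qed

text \<open>If \<open>S\<close> is first entered at \<open>t\<close>, then \<open>X t\<close>
  differs from the state at every time in \<open>{s..<t}\<close>. Shortly before \<open>t\<close>
  this has probability at most \<open>1 - exp (- c * r)\<close>, which tends to 0 with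
  \<open>r\<close>.\<close>

lemma AE_hitting_time_neq:
  assumes x: "x \<in> \<X>" and s: "0 \<le> s" and t: "s < t" and c: "\<And>y. y \<in> \<X> \<Longrightarrow> \<Lambda> y < c"
  shows "AE \<omega> in P x. hitting_time X S s \<omega> \<noteq> ereal t"
proof -
  interpret prob_space "P x" by (rule prob_space_P[OF x])
  \<comment> \<open>The factor \<open>t - s\<close> keeps \<open>t - r n\<close> from falling below
    \<open>s\<close>.\<close>
  define r where "r n = (t - s) * step n" for n
  have r: "0 < r n" "s \<le> t - r n" "r n \<le> t" for n
  proof -
    have "step n \<le> 1" by (simp add: step_def field_simps)
    then have "r n \<le> (t - s) * 1" unfolding r_def using t by (intro mult_left_mono) auto
    then show "s \<le> t - r n" "r n \<le> t" using s by auto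
    show "0 < r n" using t step_pos by (simp add: r_def)
  qed
  define E where "E n = {\<omega> \<in> space M. X (t - r n) \<omega> = X t \<omega>}" for n
  have Es: "E n \<in> events" for n
  proof -
    have "X (t - r n) \<in> borel_measurable M" "X t \<in> borel_measurable M"
      using measurable_X r[of n] s t by auto
    then have "E n \<in> sets M" unfolding E_def by (rule measurable_equality_set)
    then show ?thesis by (simp add: sets_P x)
  qed
  define N where "N = space (P x) - (\<Union>n. E n)"
  have Ns: "N \<in> events" unfolding N_def using Es by auto
  have le: "prob N \<le> 1 - exp (- c * r n)" for n
  proof -
    have "prob N \<le> prob (space (P x) - E n)"
      unfolding N_def using Es by (intro finite_measure_mono) auto
    also have "\<dots> = 1 - prob (E n)" using Es by (rule prob_compl)
    also have "\<dots> \<le> 1 - exp (- c * r n)"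
      using prob_same_state_ge[OF x, of "t - r n" "r n" c] c r[of n] s by (simp add: E_def)
    finally show ?thesis .
  qed
  have "(\<lambda>n. 1 - exp (- c * ((t - s) * step n))) \<longlonglongrightarrow> 1 - exp (- c * ((t - s) * 0))"
    by (intro tendsto_intros step_tendsto)
  then have "(\<lambda>n. 1 - exp (- c * r n)) \<longlonglongrightarrow> 0" by (simp add: r_def)
  then have "prob N \<le> 0" by (rule tendsto_lowerbound) (use le in simp_all)
  then have "prob N = 0" by (simp add: measure_le_0_iff)
  then have "N \<in> null_sets (P x)" using Ns by (auto simp: emeasure_eq_measure)
  then show ?thesis
  proof (rule AE_I')
    show "{\<omega> \<in> space (P x). \<not> hitting_time X S s \<omega> \<noteq> ereal t} \<subseteq> N"
    proof
      fix \<omega> assume "\<omega> \<in> {\<omega> \<in> space (P x). \<not> hitting_time X S s \<omega> \<noteq> ereal t}"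
      then have \<omega>: "\<omega> \<in> space (P x)" and hit: "hitting_time X S s \<omega> = ereal t" by auto
      have \<omega>M: "\<omega> \<in> space M" using \<omega> by (simp add: space_P x)
      show "\<omega> \<in> N"
        using \<omega>M s
      proof (cases rule: hitting_time_cases[where S = S])
        case never
        then show ?thesis using hit by simp
      next
        case (hit t')
        then have "t' = t" using \<open>hitting_time X S s \<omega> = ereal t\<close> by simp
        then have "X (t - r n) \<omega> \<noteq> X t \<omega>" for n using hit(3) hit(4)[of "t - r n"] r[of n] by auto
        then show ?thesis using \<omega> by (auto simp: N_def E_def)
      qed
    qed
  qed
qed

end

subsection \<open>Discounted payoffs\<close>

text \<open>The bound \<open>L\<close> is strict because \<open>trans_prob_stay_ge\<close> asks for
  a constant above the rate.\<close>

locale discounted_ctmc = ctmc \<X> M P X q \<Lambda>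
  for \<X> :: "real set" and M :: "'w measure" and P X q \<Lambda> +
  fixes \<delta> :: "real \<Rightarrow> real" and B L :: real
  assumes discount: "discount_function \<delta>"
    and states_le: "x \<in> \<X> \<Longrightarrow> x \<le> B"
    and B_nonneg: "0 \<le> B"
    and L_nonneg: "0 \<le> L"
    and rates_less: "x \<in> \<X> \<Longrightarrow> \<Lambda> x < L"
    and discount_mult: "0 < s \<Longrightarrow> 0 < t \<Longrightarrow> \<delta> s * \<delta> t \<le> \<delta> (s + t)"
begin

lemma discount_antimono: "antimono_on {0..} \<delta>"
  and discount_0: "\<delta> 0 = 1"
  and discount_lim: "(\<delta> \<longlongrightarrow> 0) at_top"
  and discount_nonneg: "0 \<le> t \<Longrightarrow> 0 \<le> \<delta> t"
  and discount_le_1: "0 \<le> t \<Longrightarrow> \<delta> t \<le> 1"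
  using discount by (auto simp: discount_function_def)

lemma discount_decr: "0 \<le> s \<Longrightarrow> s \<le> t \<Longrightarrow> \<delta> t \<le> \<delta> s"
  using discount_antimono by (auto simp: monotone_on_def)

lemma discount_mult': "0 \<le> s \<Longrightarrow> 0 \<le> t \<Longrightarrow> \<delta> s * \<delta> t \<le> \<delta> (s + t)"
  using discount_mult[of s t] by (cases "s = 0"; cases "t = 0") (auto simp: discount_0)

definition val :: "real \<Rightarrow> real set \<Rightarrow> (real \<Rightarrow> ennreal) \<Rightarrow> real \<Rightarrow> ennreal" where
  "val s S f x = (\<integral>\<^sup>+\<omega>. payoff s \<delta> S f \<omega> \<partial>P x)"

text \<open>A monotone function has countably many discontinuities, and the hitting time avoids each
  single time after \<open>s\<close> almost surely.\<close>

lemma AE_discount_cont: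
  assumes x: "x \<in> \<X>" and s: "0 \<le> s"
  shows "AE \<omega> in P x. \<forall>t. s < t \<longrightarrow> hitting_time X S s \<omega> = ereal t \<longrightarrow> isCont \<delta> t"
proof -
  define D where "D = {t \<in> {0<..}. \<not> isCont (\<lambda>t. - \<delta> t) t} \<inter> {s<..}"
  have "mono_on {0<..} (\<lambda>t. - \<delta> t)"
    by (intro mono_onI) (auto intro: discount_decr)
  then have "countable D"
    unfolding D_def using mono_on_ctble_discont_open[of "{0<..}" "\<lambda>t. - \<delta> t"] by auto
  moreover have "AE \<omega> in P x. hitting_time X S s \<omega> \<noteq> ereal t" if "t \<in> D" for t
    using that by (intro AE_hitting_time_neq[OF x s _ rates_less]) (auto simp: D_def)
  ultimately have "AE \<omega> in P x. \<forall>t\<in>D. hitting_time X S s \<omega> \<noteq> ereal t"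
    by (subst AE_ball_countable) auto
  then show ?thesis
  proof eventually_elim
    case (elim \<omega>)
    show ?case
    proof (intro allI impI)
      fix t assume t: "s < t" "hitting_time X S s \<omega> = ereal t"
      then have "isCont (\<lambda>t. - \<delta> t) t" using elim s by (auto simp: D_def)
      from continuous_minus[OF this] show "isCont \<delta> t" by simp
    qed
  qed
qed

section \<open>Convergence of the grid values to the values in continuous time\<close>

lemma AE_grid_payoff_tendsto:
  assumes x: "x \<in> \<X>" and s: "0 \<le> s"
    and "\<And>y. y \<in> \<X> \<Longrightarrow> (\<lambda>n. f n y) \<longlonglongrightarrow> g y" "\<And>y. y \<in> \<X> \<Longrightarrow> g y \<noteq> \<top>"
  shows "AE \<omega> in P x. (\<lambda>n. grid_payoff s (step n) \<delta> S (f n) \<omega>) \<longlonglongrightarrow> payoff s \<delta> S g \<omega>"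
  using AE_discount_cont[OF x s, of S] AE_space
  by eventually_elim (use assms in \<open>auto intro: grid_payoff_tendsto simp: space_P\<close>)

lemma payoff_le:
  assumes \<omega>: "\<omega> \<in> space M" and s: "0 \<le> s" and f: "\<And>y. y \<in> \<X> \<Longrightarrow> f y \<le> C"
  shows "payoff s \<delta> S f \<omega> \<le> C"
  using \<omega> s
proof (cases rule: hitting_time_cases[where S = S])
  case never
  then show ?thesis by (simp add: payoff_never)
next
  case (hit t)
  have "ennreal (\<delta> t) * f (X t \<omega>) \<le> 1 * C"
    using hit(2) s \<omega> by (intro mult_mono f X_in_states) (auto simp: discount_le_1)
  then show ?thesis by (simp add: payoff_hit[OF hit(1)])
qed

lemma val_le:
  assumes "x \<in> \<X>" "0 \<le> s" "\<And>y. y \<in> \<X> \<Longrightarrow> f y \<le> C"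
  shows "val s S f x \<le> C"
proof -
  interpret prob_space "P x" by (rule prob_space_P) fact
  have "val s S f x \<le> (\<integral>\<^sup>+\<omega>. C \<partial>P x)"
    unfolding val_def using assms by (intro nn_integral_mono payoff_le) (auto simp: space_P)
  then show ?thesis by (simp add: emeasure_space_1)
qed

text \<open>The first grid visit to \<open>S\<close>, if any, has index at least \<open>K\<close>,
  and \<delta> decreases.\<close>

lemma grid_payoff_le_free:
  assumes \<omega>: "\<omega> \<in> space M" and s: "0 \<le> s" and h: "0 < h" and f: "\<And>y. y \<in> \<X> \<Longrightarrow> f y \<le> C"
    and K: "\<And>j. j < K \<Longrightarrow> X (s + real j * h) \<omega> \<notin> S"
  shows "grid_payoff s h \<delta> S f \<omega> \<le> ennreal (\<delta> (s + real K * h)) * C"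
proof (cases "\<exists>k. X (s + real k * h) \<omega> \<in> S")
  case False
  then have "grid_payoff s h \<delta> S f \<omega> = 0" by (simp add: grid_payoff_def)
  then show ?thesis by simp
next
  case True
  define k where "k = (LEAST k. X (s + real k * h) \<omega> \<in> S)"
  have k: "X (s + real k * h) \<omega> \<in> S" unfolding k_def using True by (rule LeastI_ex)
  have free: "X (s + real j * h) \<omega> \<notin> S" if "j < k" for j
    using that unfolding k_def by (rule not_less_Least)
  have "K \<le> k" using K k not_le by blast
  then have le: "s + real K * h \<le> s + real k * h" using h by simp
  have "grid_payoff s h \<delta> S f \<omega> = ennreal (\<delta> (s + real k * h)) * f (X (s + real k * h) \<omega>)"
    by (rule grid_payoff_hit[OF \<omega> h free k])
  also have "\<dots> \<le> ennreal (\<delta> (s + real K * h)) * C"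
    using s h \<omega> le by (intro mult_mono f X_in_states ennreal_leI discount_decr) auto
  finally show ?thesis .
qed

lemma grid_payoff_le:
  assumes \<omega>: "\<omega> \<in> space M" and s: "0 \<le> s" and h: "0 < h" and f: "\<And>y. y \<in> \<X> \<Longrightarrow> f y \<le> C"
  shows "grid_payoff s h \<delta> S f \<omega> \<le> C"
proof -
  have "grid_payoff s h \<delta> S f \<omega> \<le> ennreal (\<delta> (s + real 0 * h)) * C"
    by (rule grid_payoff_le_free[OF \<omega> s h f]) auto
  also have "\<dots> \<le> 1 * C" using s by (intro mult_right_mono) (auto simp: discount_le_1)
  finally show ?thesis by simp
qed

lemma grid_payoff_val_tendsto:
  assumes x: "x \<in> \<X>" and s: "0 \<le> s" and f: "\<And>y. y \<in> \<X> \<Longrightarrow> f y \<le> ennreal C"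
  shows "(\<lambda>n. \<integral>\<^sup>+\<omega>. grid_payoff s (step n) \<delta> S f \<omega> \<partial>P x) \<longlonglongrightarrow> val s S f x"
  unfolding val_def
proof (rule nn_integral_dominated_convergence[where w = "\<lambda>_. ennreal C"])
  interpret prob_space "P x" by (rule prob_space_P[OF x])
  have top: "f y \<noteq> \<top>" if "y \<in> \<X>" for y using f[OF that] by (auto simp: top_unique)
  show "grid_payoff s (step n) \<delta> S f \<in> borel_measurable (P x)" for n
    unfolding measurable_P[OF x] using s step_pos by (intro grid_payoff_measurable) (auto simp: less_imp_le)
  show "payoff s \<delta> S f \<in> borel_measurable (P x)"
    unfolding measurable_P[OF x] by (intro payoff_measurable s discount_antimono top)
  show "AE \<omega> in P x. grid_payoff s (step n) \<delta> S f \<omega> \<le> ennreal C" for n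
    using AE_space by eventually_elim (auto intro: grid_payoff_le s step_pos f simp: space_P x)
  show "(\<integral>\<^sup>+\<omega>. ennreal C \<partial>P x) < \<infinity>" by (simp add: emeasure_space_1)
  show "AE \<omega> in P x. (\<lambda>n. grid_payoff s (step n) \<delta> S f \<omega>) \<longlonglongrightarrow> payoff s \<delta> S f \<omega>"
    by (intro AE_grid_payoff_tendsto x s top tendsto_const)
qed auto

lemma grid_val_tendsto:
  assumes "x \<in> \<X>" "\<And>y. y \<in> \<X> \<Longrightarrow> f y \<le> ennreal C"
  shows "(\<lambda>n. grid_val (step n) \<delta> S f x) \<longlonglongrightarrow> val 0 S f x"
  using grid_payoff_val_tendsto[OF assms(1) _ assms(2), where s = 0 and S = S] assms step_pos
  by (simp add: nn_integral_grid_payoff_start less_imp_le)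

text \<open>
  If \<open>A \<subseteq> S\<close>, then \<open>\<tau>\<^sub>A\<close> is \<open>\<tau>\<^sub>S\<close> plus the hitting time of \<open>A\<close> for the chain restarted at \<open>\<tau>\<^sub>S\<close>, and
  \<open>\<delta> s * \<delta> t \<le> \<delta> (s + t)\<close>. The strong Markov property is only needed on the grid; Fatou's lemma
  carries the inequality over to continuous time.
\<close>

lemma val_val_le:
  assumes AS: "A \<subseteq> S" and x: "x \<in> \<X>" and f: "\<And>y. y \<in> \<X> \<Longrightarrow> f y \<le> ennreal C"
  shows "val 0 S (val 0 A f) x \<le> val 0 A f x"
proof -
  have vtop: "val 0 A f y \<noteq> \<top>" if "y \<in> \<X>" for y
  proof -
    have "val 0 A f y \<le> ennreal C" using that by (intro val_le f) auto
    then show ?thesis by (auto simp: top_unique)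
  qed
  have "val 0 S (val 0 A f) x =
      (\<integral>\<^sup>+\<omega>. liminf (\<lambda>n. grid_payoff 0 (step n) \<delta> S (grid_val (step n) \<delta> A f) \<omega>) \<partial>P x)"
    unfolding val_def[of 0 S]
  proof (rule nn_integral_cong_AE)
    \<comment> \<open>Inner and outer value live on the same grid, so that
      \<open>grid_val_le\<close> applies for each \<open>n\<close>; this is why the reward varies
      with \<open>n\<close>.\<close>
    have "AE \<omega> in P x. (\<lambda>n. grid_payoff 0 (step n) \<delta> S (grid_val (step n) \<delta> A f) \<omega>)
        \<longlonglongrightarrow> payoff 0 \<delta> S (val 0 A f) \<omega>"
      by (intro AE_grid_payoff_tendsto x grid_val_tendsto[where C = C] f vtop) auto
    then show "AE \<omega> in P x. payoff 0 \<delta> S (val 0 A f) \<omega> =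
        liminf (\<lambda>n. grid_payoff 0 (step n) \<delta> S (grid_val (step n) \<delta> A f) \<omega>)"
      by eventually_elim (simp add: lim_imp_Liminf)
  qed
  also have "\<dots> \<le> liminf (\<lambda>n. \<integral>\<^sup>+\<omega>. grid_payoff 0 (step n) \<delta> S (grid_val (step n) \<delta> A f) \<omega> \<partial>P x)"
    unfolding measurable_P[OF x, symmetric]
    by (intro nn_integral_liminf) (simp add: measurable_P x grid_payoff_measurable step_pos less_imp_le)
  also have "\<dots> \<le> liminf (\<lambda>n. grid_val (step n) \<delta> A f x)"
    using x step_pos AS discount_nonneg discount_mult'
    by (intro Liminf_mono always_eventually allI)
      (simp add: nn_integral_grid_payoff_start less_imp_le grid_val_le)
  also have "\<dots> = val 0 A f x"
    by (intro lim_imp_Liminf grid_val_tendsto[where C = C] x f) auto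
  finally show ?thesis .
qed

section \<open>The value as a functional of the reward\<close>

lemma payoff_measurable_P:
  "x \<in> \<X> \<Longrightarrow> 0 \<le> s \<Longrightarrow> (\<And>y. y \<in> \<X> \<Longrightarrow> f y \<noteq> \<top>) \<Longrightarrow> payoff s \<delta> S f \<in> borel_measurable (P x)"
  by (simp only: measurable_P) (rule payoff_measurable[OF _ discount_antimono])

lemma val_mono:
  assumes x: "x \<in> \<X>" and s: "0 \<le> s" and f: "\<And>y. y \<in> S \<Longrightarrow> y \<in> \<X> \<Longrightarrow> f y \<le> g y"
  shows "val s S f x \<le> val s S g x"
  unfolding val_def
proof (rule nn_integral_mono)
  fix \<omega> assume "\<omega> \<in> space (P x)"
  then have \<omega>: "\<omega> \<in> space M" by (simp add: space_P x)
  show "payoff s \<delta> S f \<omega> \<le> payoff s \<delta> S g \<omega>"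
    using \<omega> s
  proof (cases rule: hitting_time_cases[where S = S])
    case never
    then show ?thesis by (simp add: payoff_never)
  next
    case (hit t)
    then show ?thesis using \<omega> s by (auto simp: payoff_hit intro!: mult_left_mono f X_in_states)
  qed
qed

lemma val_add:
  assumes "x \<in> \<X>" "0 \<le> s" "\<And>y. y \<in> \<X> \<Longrightarrow> f y \<noteq> \<top>" "\<And>y. y \<in> \<X> \<Longrightarrow> g y \<noteq> \<top>"
  shows "val s S (\<lambda>y. f y + g y) x = val s S f x + val s S g x"
proof -
  have "payoff s \<delta> S (\<lambda>y. f y + g y) \<omega> = payoff s \<delta> S f \<omega> + payoff s \<delta> S g \<omega>" for \<omega>
    by (simp add: payoff_def distrib_left)
  then have "val s S (\<lambda>y. f y + g y) x = (\<integral>\<^sup>+\<omega>. payoff s \<delta> S f \<omega> + payoff s \<delta> S g \<omega> \<partial>P x)"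
    unfolding val_def by (rule nn_integral_cong)
  also have "\<dots> = val s S f x + val s S g x"
    unfolding val_def using assms by (intro nn_integral_add payoff_measurable_P)
  finally show ?thesis .
qed

lemma val_const:
  assumes "x \<in> \<X>" "0 \<le> s"
  shows "val s S (\<lambda>_. c) x = c * val s S (\<lambda>_. 1) x"
proof -
  have "payoff s \<delta> S (\<lambda>_. c) \<omega> = c * payoff s \<delta> S (\<lambda>_. 1) \<omega>" for \<omega>
    by (simp add: payoff_def mult.commute)
  then have "val s S (\<lambda>_. c) x = (\<integral>\<^sup>+\<omega>. c * payoff s \<delta> S (\<lambda>_. 1) \<omega> \<partial>P x)"
    unfolding val_def by (rule nn_integral_cong)
  also have "\<dots> = c * val s S (\<lambda>_. 1) x"
    unfolding val_def using assms by (intro nn_integral_cmult payoff_measurable_P) auto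
  finally show ?thesis .
qed

text \<open>On every grid only the summand of index 0 survives, so the limit is immediate.\<close>

lemma val_in:
  assumes x: "x \<in> \<X>" "x \<in> S" and f: "\<And>y. y \<in> \<X> \<Longrightarrow> f y \<le> ennreal C"
  shows "val 0 S f x = f x"
proof -
  have "hit_val h S f (Suc k) x = 0" for h k using x by simp
  then have "grid_val h \<delta> S f x = f x" for h
    unfolding grid_val_def using x
    by (subst suminf_finite[of "{0}"]) (auto simp: discount_0 gr0_conv_Suc simp del: hit_val.simps(2))
  moreover have "(\<lambda>n. grid_val (step n) \<delta> S f x) \<longlonglongrightarrow> val 0 S f x"
    by (rule grid_val_tendsto[OF x(1) f])
  ultimately show ?thesis by (simp add: LIMSEQ_const_iff)
qed

lemma val_1_le:
  assumes "x \<in> \<X>" "0 \<le> s"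
  shows "val s S (\<lambda>_. 1) x \<le> 1"
  using assms by (intro val_le) auto

section \<open>The functional \<open>J\<close> and its comparison for nested sets\<close>

lemma ennreal_state_le: "y \<in> \<X> \<Longrightarrow> ennreal y \<le> ennreal B"
  by (intro ennreal_leI states_le)

text \<open>The bridge from the Bochner integral in \<open>J_from\<close> to the nonnegative
  integral in \<open>val\<close>; the bound \<open>B\<close> keeps the latter finite, so nothing is
  lost in \<open>enn2real\<close>.\<close>

lemma ennreal_J_from:
  assumes x: "x \<in> \<X>" and s: "0 \<le> s"
  shows "ennreal (J_from P X \<delta> s x S) = val s S ennreal x"
proof -
  let ?g = "stopped_payoff X \<delta> (hitting_time X S s)"
  have eq: "ennreal (?g \<omega>) = payoff s \<delta> S ennreal \<omega> \<and> 0 \<le> ?g \<omega>" if \<omega>: "\<omega> \<in> space M" for \<omega>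
    using \<omega> s
  proof (cases rule: hitting_time_cases[where S = S])
    case never
    then show ?thesis by (simp add: payoff_never stopped_payoff_def)
  next
    case (hit t)
    have "0 \<le> X t \<omega>" using X_in_states[of t \<omega>] states_nonneg hit(2) s \<omega> by auto
    then show ?thesis
      using hit s by (simp add: payoff_hit stopped_payoff_def discount_nonneg ennreal_mult)
  qed
  have "(\<lambda>\<omega>. enn2real (payoff s \<delta> S ennreal \<omega>)) \<in> borel_measurable (P x)"
    using payoff_measurable_P[OF x s, of ennreal S] by simp
  moreover have "enn2real (payoff s \<delta> S ennreal \<omega>) = ?g \<omega>" if "\<omega> \<in> space (P x)" for \<omega>
    using eq[of \<omega>] that x by (metis enn2real_ennreal space_P)
  ultimately have "?g \<in> borel_measurable (P x)" by (simp cong: measurable_cong)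
  then have "J_from P X \<delta> s x S = enn2real (\<integral>\<^sup>+\<omega>. ennreal (?g \<omega>) \<partial>P x)"
    unfolding J_from_def using eq by (intro integral_eq_nn_integral AE_I2) (auto simp: space_P x)
  also have "(\<integral>\<^sup>+\<omega>. ennreal (?g \<omega>) \<partial>P x) = val s S ennreal x"
    unfolding val_def using eq by (intro nn_integral_cong) (auto simp: space_P x)
  finally have "J_from P X \<delta> s x S = enn2real (val s S ennreal x)" .
  moreover have "val s S ennreal x \<le> ennreal B"
    by (intro val_le x s ennreal_state_le)
  then have "val s S ennreal x < \<top>" using ennreal_less_top by (rule le_less_trans)
  ultimately show ?thesis by simp
qed

lemma ennreal_J: "x \<in> \<X> \<Longrightarrow> ennreal (J P X \<delta> x S) = val 0 S ennreal x"
  by (simp add: J_def ennreal_J_from)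

lemma J_nonneg:
  assumes "x \<in> \<X>"
  shows "0 \<le> J P X \<delta> x S"
proof -
  have "0 \<le> (\<integral>\<omega>. stopped_payoff X \<delta> (hitting_time X S 0) \<omega> \<partial>P x)"
  proof (rule integral_nonneg_AE, rule AE_I2)
    fix \<omega> assume "\<omega> \<in> space (P x)"
    then have \<omega>: "\<omega> \<in> space M" by (simp add: space_P assms)
    show "0 \<le> stopped_payoff X \<delta> (hitting_time X S 0) \<omega>"
      using \<omega> order_refl
    proof (cases rule: hitting_time_cases[where S = S])
      case never
      then show ?thesis by (simp add: stopped_payoff_def)
    next
      case (hit t)
      then have "0 \<le> X t \<omega>" using X_in_states[of t \<omega>] states_nonneg \<omega> by auto
      then show ?thesis using hit by (simp add: stopped_payoff_def discount_nonneg)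
    qed
  qed
  then show ?thesis by (simp add: J_def J_from_def)
qed

lemma J_le: "x \<in> \<X> \<Longrightarrow> J P X \<delta> x S \<le> B"
proof -
  assume x: "x \<in> \<X>"
  have "ennreal (J P X \<delta> x S) \<le> ennreal B"
    unfolding ennreal_J[OF x] by (intro val_le x ennreal_state_le) auto
  then show ?thesis using B_nonneg by simp
qed

lemma J_in: "x \<in> \<X> \<Longrightarrow> x \<in> S \<Longrightarrow> J P X \<delta> x S = x"
proof -
  assume x: "x \<in> \<X>" "x \<in> S"
  have "ennreal (J P X \<delta> x S) = ennreal x"
    unfolding ennreal_J[OF x(1)] by (rule val_in[OF x ennreal_state_le])
  then show ?thesis using J_nonneg[OF x(1)] x(1) states_nonneg by auto
qed

text \<open>By \<open>val_val_le\<close>, collecting \<open>J\<close> of \<open>A\<close> on arrival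
  in \<open>S\<close> is worth at most \<open>J\<close> of \<open>A\<close> at \<open>x\<close>; the
  excess \<open>a\<close> is paid on arrival, hence shrinks by the expected discount. It yields the
  contraction for \<open>c < 1\<close>, optimality for \<open>a = 0\<close>, and the effect of
  removing one state from the equilibrium.\<close>

lemma J_le_J_subset:
  assumes AS: "A \<subseteq> S" and x: "x \<in> \<X>" and a: "0 \<le> a" and disc: "val 0 S (\<lambda>_. 1) x \<le> ennreal c"
    and c: "0 \<le> c" and le: "\<And>y. y \<in> S \<Longrightarrow> y \<in> \<X> \<Longrightarrow> y \<le> J P X \<delta> y A + a"
  shows "J P X \<delta> x S \<le> J P X \<delta> x A + a * c"
proof -
  have vtop: "val 0 A ennreal y \<noteq> \<top>" if "y \<in> \<X>" for y
    unfolding ennreal_J[OF that, symmetric] by simp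
  have "ennreal (J P X \<delta> x S) \<le> val 0 S (\<lambda>y. val 0 A ennreal y + ennreal a) x"
    unfolding ennreal_J[OF x]
  proof (rule val_mono[OF x order_refl])
    fix y assume y: "y \<in> S" "y \<in> \<X>"
    show "ennreal y \<le> val 0 A ennreal y + ennreal a"
      using ennreal_leI[OF le[OF y]] a J_nonneg[OF y(2)]
      by (simp add: ennreal_J[OF y(2), symmetric])
  qed
  also have "\<dots> = val 0 S (val 0 A ennreal) x + ennreal a * val 0 S (\<lambda>_. 1) x"
    using x vtop val_const[OF x order_refl, of S "ennreal a"] by (simp add: val_add)
  also have "\<dots> \<le> ennreal (J P X \<delta> x A) + ennreal a * ennreal c"
    unfolding ennreal_J[OF x]
    by (intro add_mono mult_left_mono disc val_val_le[OF AS x ennreal_state_le]) auto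
  also have "\<dots> = ennreal (J P X \<delta> x A + a * c)"
    using a c J_nonneg[OF x] by (simp add: ennreal_mult ennreal_plus)
  finally show ?thesis using a c J_nonneg[OF x] by (subst (asm) ennreal_le_iff) auto
qed

text \<open>A chain started outside \<open>S\<close> stays put for a while with a probability bounded from below.\<close>

lemma val_1_outside_le:
  obtains c where "0 \<le> c" "c < 1" "\<And>x S. x \<in> \<X> \<Longrightarrow> x \<notin> S \<Longrightarrow> val 0 S (\<lambda>_. 1) x \<le> ennreal c"
proof -
  have "\<forall>\<^sub>F t in at_top. \<delta> t < 1" by (rule order_tendstoD(2)[OF discount_lim]) simp
  then obtain t0 where t0: "\<And>t. t \<ge> t0 \<Longrightarrow> \<delta> t < 1" by (auto simp: eventually_at_top_linorder)
  \<comment> \<open>A time after which discounting is strict.\<close>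
  obtain N where N: "t0 \<le> real N" using real_arch_simple by blast
  have \<delta>N: "0 \<le> \<delta> (real N)" "\<delta> (real N) < 1" using t0[OF N] by (auto simp: discount_nonneg)
  define e where "e = exp (- L * real N)"
  \<comment> \<open>With probability at least \<open>e\<close> the chain is seen in \<open>x\<close>
    at all grid times before \<open>N\<close>, and then the discount factor is at most
    \<open>\<delta> N\<close>; otherwise it is at most 1.\<close>
  define c where "c = 1 - e * (1 - \<delta> (real N))"
  have e: "0 < e" "e \<le> 1" using L_nonneg by (auto simp: e_def)
  have "e * (1 - \<delta> (real N)) \<le> 1 * 1" using e \<delta>N by (intro mult_mono) auto
  then have c: "0 \<le> c" "c < 1" using e \<delta>N by (auto simp: c_def)
  have "val 0 S (\<lambda>_. 1) x \<le> ennreal c" if x: "x \<in> \<X>" "x \<notin> S" for x S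
  proof (rule LIMSEQ_le_const2)
    interpret prob_space "P x" by (rule prob_space_P[OF x(1)])
    show "(\<lambda>n. \<integral>\<^sup>+\<omega>. grid_payoff 0 (step n) \<delta> S (\<lambda>_. 1) \<omega> \<partial>P x) \<longlonglongrightarrow> val 0 S (\<lambda>_. 1) x"
      by (rule grid_payoff_val_tendsto[OF x(1), where C = 1]) auto
    have "(\<integral>\<^sup>+\<omega>. grid_payoff 0 (step n) \<delta> S (\<lambda>_. 1) \<omega> \<partial>P x) \<le> ennreal c" for n
    proof -
      define h where "h = step n"
      have h: "0 < h" unfolding h_def by (rule step_pos)
      \<comment> \<open>Avoiding the complement of \<open>{x}\<close> means being in
        \<open>x\<close> at the first \<open>k\<close> grid times.\<close>
      let ?A = "\<lambda>k. grid_free 0 h (- {x}) k"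
      have As: "?A k \<in> events" for k using grid_free_sets[of 0 h "- {x}" k] h by (simp add: sets_P x)
      have A: "exp (- L * (real k * h)) \<le> prob (?A (Suc k))" for k
      proof (induction k)
        case 0
        have "?A (Suc 0) = {\<omega> \<in> space M. X 0 \<omega> = x}" by (auto simp: grid_free_def)
        then show ?case using start[OF x(1)] by (simp add: trans_prob_def)
      next
        case (Suc k)
        have hist: "?A k \<in> history M X (real k * h)"
          using h by (intro grid_free_history) auto
        have kh: "0 \<le> real k * h" using h by simp
        have "{\<omega> \<in> ?A k. X (real k * h) \<omega> = x} = ?A (Suc k)"
          by (auto simp: grid_free_def less_Suc_eq)
        moreover have "{\<omega> \<in> ?A k. X (real k * h) \<omega> = x \<and> X (real k * h + h) \<omega> = x} = ?A (Suc (Suc k))"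
          by (auto simp: grid_free_def less_Suc_eq distrib_right add.commute)
        ultimately have "prob (?A (Suc (Suc k))) = prob (?A (Suc k)) * trans_prob M P X h x x"
          using markov[OF x(1) x(1) x(1) kh less_imp_le[OF h] hist] by simp
        moreover have "exp (- L * (real k * h)) * exp (- L * h) \<le> prob (?A (Suc k)) * trans_prob M P X h x x"
          using h by (intro mult_mono Suc trans_prob_stay_ge rates_less x) auto
        moreover have "exp (- L * (real (Suc k) * h)) = exp (- L * (real k * h)) * exp (- L * h)"
          by (simp add: exp_add[symmetric] algebra_simps)
        ultimately show ?case by simp
      qed
      \<comment> \<open>The index at which the grid reaches time \<open>N\<close>.\<close>
      define K where "K = N * Suc n"
      have Kh: "real K * h = real N" by (simp add: K_def h_def step_def field_simps)
      have pA: "e \<le> prob (?A K)"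
      proof -
        have "prob (?A (Suc K)) \<le> prob (?A K)"
          by (rule finite_measure_mono[OF _ As]) (auto simp: grid_free_def)
        then show ?thesis using A[of K] unfolding e_def Kh by linarith
      qed
      have int: "integrable (P x) (indicator (?A K) :: 'w \<Rightarrow> real)"
        by (intro integrable_real_indicator As) (simp add: emeasure_eq_measure)
      have "(\<integral>\<^sup>+\<omega>. grid_payoff 0 h \<delta> S (\<lambda>_. 1) \<omega> \<partial>P x) \<le>
          (\<integral>\<^sup>+\<omega>. ennreal (1 - (1 - \<delta> (real N)) * indicator (?A K) \<omega>) \<partial>P x)"
      proof (rule nn_integral_mono)
        fix \<omega> assume "\<omega> \<in> space (P x)"
        then have \<omega>: "\<omega> \<in> space M" by (simp add: space_P x)
        show "grid_payoff 0 h \<delta> S (\<lambda>_. 1) \<omega> \<le> ennreal (1 - (1 - \<delta> (real N)) * indicator (?A K) \<omega>)"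
        proof (cases "\<omega> \<in> ?A K")
          case True
          have "grid_payoff 0 h \<delta> S (\<lambda>_. 1) \<omega> \<le> ennreal (\<delta> (0 + real K * h)) * 1"
          proof (rule grid_payoff_le_free[OF \<omega> order_refl h order_refl])
            fix j assume "j < K"
            then show "X (0 + real j * h) \<omega> \<notin> S" using True x(2) by (auto simp: grid_free_def)
          qed
          then show ?thesis using True by (simp add: Kh)
        next
          case False
          then show ?thesis using grid_payoff_le[OF \<omega> order_refl h, of "\<lambda>_. 1" 1 S] by simp
        qed
      qed
      also have "\<dots> = ennreal (\<integral>\<omega>. 1 - (1 - \<delta> (real N)) * indicator (?A K) \<omega> \<partial>P x)"
        using \<delta>N by (intro nn_integral_eq_integral Bochner_Integration.integrable_diff integrable_const
          integrable_mult_right int) (auto simp: indicator_def)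
      also have "(\<integral>\<omega>. 1 - (1 - \<delta> (real N)) * indicator (?A K) \<omega> \<partial>P x) =
          1 - (1 - \<delta> (real N)) * prob (?A K)"
        using int sets.Int_space_eq2[OF As[of K]]
        by (subst Bochner_Integration.integral_diff) (auto simp: prob_space)
      also have "\<dots> \<le> c"
        using mult_left_mono[OF pA, of "1 - \<delta> (real N)"] \<delta>N by (simp add: c_def mult.commute)
      finally show ?thesis by (simp add: h_def ennreal_leI)
    qed
    then show "\<exists>N. \<forall>n\<ge>N. (\<integral>\<^sup>+\<omega>. grid_payoff 0 (step n) \<delta> S (\<lambda>_. 1) \<omega> \<partial>P x) \<le> ennreal c" by blast
  qed
  with c show thesis by (intro that[of c])
qed

subsection \<open>The optimal mild equilibrium\<close>

text \<open>Up to a late time \<open>t0\<close> the path visits finitely many states, and each of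
  them drops out of the decreasing sets eventually. From then on \<open>R n\<close> is hit no
  earlier than \<open>t0\<close>, where the discount is small.\<close>

lemma payoff_1_tendsto_0:
  assumes dec: "decseq R" and empty: "(\<Inter>n. R n) = {}" and \<omega>: "\<omega> \<in> space M"
  shows "(\<lambda>n. payoff 0 \<delta> (R n) (\<lambda>_. 1) \<omega>) \<longlonglongrightarrow> 0"
proof (rule order_tendstoI)
  fix a :: ennreal assume a: "0 < a"
  \<comment> \<open>A positive real threshold, also when \<open>a\<close> is infinite.\<close>
  define a' where "a' = enn2real (min a 1)"
  have a': "0 < a'" "ennreal a' \<le> a"
  proof -
    have fin: "min a 1 < \<top>" by (simp add: min_less_iff_disj)
    show "0 < a'" unfolding a'_def using a fin by (simp add: enn2real_positive_iff)
    show "ennreal a' \<le> a" unfolding a'_def using fin by (simp add: ennreal_enn2real)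
  qed
  have "\<forall>\<^sub>F t in at_top. \<delta> t < a'" by (rule order_tendstoD(2)[OF discount_lim a'(1)])
  then obtain t0 where t0: "\<And>t. t \<ge> t0 \<Longrightarrow> \<delta> t < a'" by (auto simp: eventually_at_top_linorder)
  define F where "F = (\<lambda>u. X u \<omega>) ` {0..t0}"
  have F: "finite F" unfolding F_def by (rule path_finite_range[OF \<omega>])
  have "\<forall>y\<in>F. \<forall>\<^sub>F n in sequentially. y \<notin> R n"
  proof
    fix y
    obtain m where "y \<notin> R m" using empty by auto
    then have "y \<notin> R n" if "n \<ge> m" for n using decseqD[OF dec that] by auto
    then show "\<forall>\<^sub>F n in sequentially. y \<notin> R n" by (auto simp: eventually_sequentially)
  qed
  then have "\<forall>\<^sub>F n in sequentially. \<forall>y\<in>F. y \<notin> R n" using F by (simp add: eventually_ball_finite)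
  then show "\<forall>\<^sub>F n in sequentially. payoff 0 \<delta> (R n) (\<lambda>_. 1) \<omega> < a"
  proof eventually_elim
    case (elim n)
    show ?case
      using \<omega> order_refl
    proof (cases rule: hitting_time_cases[where S = "R n"])
      case never
      then show ?thesis using a by (simp add: payoff_never)
    next
      case (hit t)
      have "t0 \<le> t"
      proof (rule ccontr)
        assume "\<not> t0 \<le> t"
        then have "X t \<omega> \<in> F" using hit(2) by (auto simp: F_def)
        then show False using elim hit(3) by auto
      qed
      then have "ennreal (\<delta> t) < ennreal a'" using t0[of t] a' by (simp add: ennreal_lessI)
      also have "\<dots> \<le> a" by (rule a')
      finally show ?thesis by (simp add: payoff_hit[OF hit(1)])
    qed
  qed
qed auto

lemma val_1_tendsto_0:
  assumes dec: "decseq R" and empty: "(\<Inter>n. R n) = {}" and x: "x \<in> \<X>"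
  shows "(\<lambda>n. val 0 (R n) (\<lambda>_. 1) x) \<longlonglongrightarrow> 0"
proof -
  interpret prob_space "P x" by (rule prob_space_P[OF x])
  have "(\<lambda>n. \<integral>\<^sup>+\<omega>. payoff 0 \<delta> (R n) (\<lambda>_. 1) \<omega> \<partial>P x) \<longlonglongrightarrow> (\<integral>\<^sup>+\<omega>. 0 \<partial>P x)"
  proof (rule nn_integral_dominated_convergence[where w = "\<lambda>_. 1"])
    show "payoff 0 \<delta> (R n) (\<lambda>_. 1) \<in> borel_measurable (P x)" for n
      by (intro payoff_measurable_P x) auto
    show "AE \<omega> in P x. payoff 0 \<delta> (R n) (\<lambda>_. 1) \<omega> \<le> 1" for n
      by (rule AE_I2) (auto intro: payoff_le simp: space_P x)
    show "AE \<omega> in P x. (\<lambda>n. payoff 0 \<delta> (R n) (\<lambda>_. 1) \<omega>) \<longlonglongrightarrow> 0"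
      by (rule AE_I2) (simp only: space_P x payoff_1_tendsto_0[OF dec empty])
  qed (auto simp: emeasure_space_1)
  then show ?thesis by (simp add: val_def)
qed

text \<open>Enlarging \<open>S\<close> by \<open>R\<close> changes the payoff only on paths that
  meet \<open>R\<close> before \<open>S\<close>. There the payoff of \<open>S\<close> is at most
  \<open>B\<close> times the discount at the hitting time of \<open>R\<close>.\<close>

lemma J_le_J_Un:
  assumes x: "x \<in> \<X>"
  shows "J P X \<delta> x S \<le> J P X \<delta> x (S \<union> R) + B * enn2real (val 0 R (\<lambda>_. 1) x)"
proof -
  have pw: "payoff 0 \<delta> S ennreal \<omega> \<le> payoff 0 \<delta> (S \<union> R) ennreal \<omega> + ennreal B * payoff 0 \<delta> R (\<lambda>_. 1) \<omega>"
    if \<omega>: "\<omega> \<in> space M" for \<omega>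
    using \<omega> order_refl
  proof (cases rule: hitting_time_cases[where S = S])
    case never
    then show ?thesis by (simp add: payoff_never)
  next
    case (hit t)
    show ?thesis
      using \<omega> order_refl
    proof (cases rule: hitting_time_cases[where S = "S \<union> R"])
      case never
      then show ?thesis using hit by auto
    next
      case hit': (hit t')
      have t't: "t' \<le> t" using hit'(4)[of t] hit by force
      show ?thesis
      proof (cases "X t' \<omega> \<in> S")
        case True
        then have "t = t'" using hit(4)[of t'] hit'(2) t't by force
        then show ?thesis by (simp add: payoff_hit[OF hit(1)] payoff_hit[OF hit'(1)])
      next
        case False
        then have "X t' \<omega> \<in> R" using hit'(3) by simp
        show ?thesis
          using \<omega> order_refl
        proof (cases rule: hitting_time_cases[where S = R])
          case never
          then show ?thesis using \<open>X t' \<omega> \<in> R\<close> hit'(2) by auto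
        next
          case hit'': (hit t'')
          have "t'' = t'" using hit'(4)[of t''] hit''(2,3) hit''(4)[of t'] hit'(2) \<open>X t' \<omega> \<in> R\<close> by force
          have "ennreal (\<delta> t) * ennreal (X t \<omega>) \<le> ennreal (\<delta> t') * ennreal B"
            using hit(2) hit'(2) t't \<omega>
            by (intro mult_mono ennreal_state_le ennreal_leI discount_decr X_in_states) auto
          then have "payoff 0 \<delta> S ennreal \<omega> \<le> ennreal B * payoff 0 \<delta> R (\<lambda>_. 1) \<omega>"
            by (simp add: payoff_hit[OF hit(1)] payoff_hit[OF hit''(1)] \<open>t'' = t'\<close> mult.commute)
          then show ?thesis by (rule order_trans) simp
        qed
      qed
    qed
  qed
  have "ennreal (J P X \<delta> x S) \<le>
      (\<integral>\<^sup>+\<omega>. payoff 0 \<delta> (S \<union> R) ennreal \<omega> + ennreal B * payoff 0 \<delta> R (\<lambda>_. 1) \<omega> \<partial>P x)"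
    unfolding ennreal_J[OF x] val_def using pw by (intro nn_integral_mono) (auto simp: space_P x)
  also have "\<dots> = val 0 (S \<union> R) ennreal x + ennreal B * val 0 R (\<lambda>_. 1) x"
  proof -
    have "payoff 0 \<delta> (S \<union> R) ennreal \<in> borel_measurable (P x)" "payoff 0 \<delta> R (\<lambda>_. 1) \<in> borel_measurable (P x)"
      by (auto intro: payoff_measurable_P x)
    then show ?thesis unfolding val_def by (simp only: nn_integral_add nn_integral_cmult borel_measurable_times_ennreal borel_measurable_const)
  qed
  also have "val 0 R (\<lambda>_. 1) x = ennreal (enn2real (val 0 R (\<lambda>_. 1) x))"
  proof -
    have "val 0 R (\<lambda>_. 1) x < \<top>" using val_1_le[OF x order_refl, of R] by (rule le_less_trans) simp
    then show ?thesis by simp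
  qed
  also have "val 0 (S \<union> R) ennreal x + ennreal B * \<dots> =
      ennreal (J P X \<delta> x (S \<union> R) + B * enn2real (val 0 R (\<lambda>_. 1) x))"
    using B_nonneg J_nonneg[OF x, of "S \<union> R"]
    by (simp add: ennreal_J[OF x, symmetric] ennreal_mult ennreal_plus)
  finally show ?thesis
    using B_nonneg J_nonneg[OF x, of "S \<union> R"] by (subst (asm) ennreal_le_iff) auto
qed

section \<open>The iteration and its limit set\<close>

abbreviation Siter :: "nat \<Rightarrow> real set" where
  "Siter n \<equiv> S_iter \<X> P X \<delta> n"

abbreviation Sinf :: "real set" where
  "Sinf \<equiv> S_infinity \<X> P X \<delta>"

lemma Siter_subset: "Siter n \<subseteq> \<X>"
  by (induction n) auto

lemma Sinf_subset: "Sinf \<subseteq> \<X>"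
  using Siter_subset by (auto simp: S_infinity_def)

lemma incseq_Siter: "incseq Siter"
  by (rule incseq_SucI) auto

lemma J_bdd_above: "x \<in> \<X> \<Longrightarrow> bdd_above ((\<lambda>S. J P X \<delta> x S) ` \<S>)"
  using J_le by (intro bdd_aboveI2)

lemma Siter_Suc_D:
  assumes "x \<in> Siter (Suc n)" "x \<notin> Siter n" "Siter n \<subseteq> S" "S \<subseteq> \<X> - {x}"
  shows "J P X \<delta> x S < x"
proof -
  have x: "x \<in> \<X>" "(SUP S \<in> {S. Siter n \<subseteq> S \<and> S \<subseteq> \<X> - {x}}. J P X \<delta> x S) < x"
    using assms(1,2) by auto
  have "J P X \<delta> x S \<le> (SUP S \<in> {S. Siter n \<subseteq> S \<and> S \<subseteq> \<X> - {x}}. J P X \<delta> x S)"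
    using assms(3,4) by (intro cSUP_upper J_bdd_above x(1)) auto
  with x(2) show ?thesis by simp
qed

text \<open>A state outside \<open>Sinf\<close> is not added at stage \<open>Suc n\<close>, so the
  supremum that decides this is at least \<open>x\<close>. The stage \<open>n\<close> can be chosen
  freely.\<close>

lemma not_Sinf_D:
  assumes x: "x \<in> \<X>" "x \<notin> Sinf" and \<epsilon>: "0 < \<epsilon>"
  obtains S where "Siter n \<subseteq> S" "S \<subseteq> \<X> - {x}" "x - \<epsilon> < J P X \<delta> x S"
proof -
  let ?S = "{S. Siter n \<subseteq> S \<and> S \<subseteq> \<X> - {x}}"
  have nin: "x \<notin> Siter n" "x \<notin> Siter (Suc n)" using x by (auto simp only: S_infinity_def)
  then have "x \<le> (SUP S \<in> ?S. J P X \<delta> x S)" using x(1) by (auto simp: not_less)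
  then have "x - \<epsilon> < (SUP S \<in> ?S. J P X \<delta> x S)" using \<epsilon> by simp
  moreover have "?S \<noteq> {}" using nin(1) Siter_subset[of n] by auto
  ultimately obtain S where "S \<in> ?S" "x - \<epsilon> < J P X \<delta> x S"
    using J_bdd_above[OF x(1)] by (subst (asm) less_cSUP_iff) auto
  then show thesis by (intro that) auto
qed

text \<open>The deficit \<open>y - J\<close> is at most \<open>B\<close>, and each round of
  comparison multiplies its uniform bound by \<open>c < 1\<close>; hence it is not positive.\<close>

lemma Sinf_le_J:
  assumes x: "x \<in> \<X>"
  shows "x \<le> J P X \<delta> x Sinf"
proof -
  obtain c where c: "0 \<le> c" "c < 1" "\<And>x S. x \<in> \<X> \<Longrightarrow> x \<notin> S \<Longrightarrow> val 0 S (\<lambda>_. 1) x \<le> ennreal c"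
    by (rule val_1_outside_le) (rule that)
  have contract: "y - J P X \<delta> y Sinf \<le> B * c ^ m" if "y \<in> \<X>" for y m
    using that
  proof (induction m arbitrary: y)
    case 0
    then show ?case using states_le[of y] J_nonneg[of y Sinf] by simp
  next
    case (Suc m)
    note y = Suc.prems
    show ?case
    proof (cases "y \<in> Sinf")
      case True
      then show ?thesis using J_in[OF y, of Sinf] B_nonneg c(1) by simp
    next
      case False
      \<comment> \<open>Up to the factor \<open>B\<close>, the cost of enlarging a set that contains
        \<open>Siter n\<close> to one that contains \<open>Sinf\<close>. It vanishes in the limit
        because the remainders decrease to the empty set.\<close>
      define D where "D n = enn2real (val 0 (Sinf - Siter n) (\<lambda>_. 1) y)" for n
      have "decseq (\<lambda>n. Sinf - Siter n)" using incseq_Siter by (auto simp: decseq_def incseq_def)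
      moreover have "(\<Inter>n. Sinf - Siter n) = {}" by (auto simp: S_infinity_def)
      ultimately have "(\<lambda>n. val 0 (Sinf - Siter n) (\<lambda>_. 1) y) \<longlonglongrightarrow> 0"
        by (intro val_1_tendsto_0 y)
      then have "D \<longlonglongrightarrow> enn2real 0"
        unfolding D_def by (intro tendsto_enn2real) auto
      then have D: "D \<longlonglongrightarrow> 0" by simp
      have le: "y \<le> J P X \<delta> y Sinf + B * c ^ m * c + B * D n + \<epsilon>" if \<epsilon>: "0 < \<epsilon>" for n \<epsilon>
      proof -
        obtain S where S: "Siter n \<subseteq> S" "S \<subseteq> \<X> - {y}" "y - \<epsilon> < J P X \<delta> y S"
          using not_Sinf_D[OF y False \<epsilon>] .
        have Un: "S \<union> (Sinf - Siter n) = S \<union> Sinf" using S(1) by auto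
        have "J P X \<delta> y S \<le> J P X \<delta> y (S \<union> Sinf) + B * D n"
          using J_le_J_Un[OF y, of S "Sinf - Siter n"] by (simp add: Un D_def)
        \<comment> \<open>By the induction hypothesis every state of the union has deficit at most
          \<open>B * c ^ m\<close>, and \<open>y\<close> lies outside the union, which gains the
          factor \<open>c\<close>.\<close>
        moreover have "J P X \<delta> y (S \<union> Sinf) \<le> J P X \<delta> y Sinf + B * c ^ m * c"
        proof (rule J_le_J_subset[OF _ y])
          show "val 0 (S \<union> Sinf) (\<lambda>_. 1) y \<le> ennreal c" using S(2) False by (intro c y) auto
          show "z \<le> J P X \<delta> z Sinf + B * c ^ m" if "z \<in> S \<union> Sinf" "z \<in> \<X>" for z
            using Suc.IH[OF that(2)] by simp
        qed (use B_nonneg c in auto)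
        ultimately show ?thesis using S(3) by simp
      qed
      have "y \<le> J P X \<delta> y Sinf + B * c ^ m * c + B * D n" for n
        by (rule field_le_epsilon) (rule le)
      moreover have "(\<lambda>n. J P X \<delta> y Sinf + B * c ^ m * c + B * D n) \<longlonglongrightarrow> J P X \<delta> y Sinf + B * c ^ m * c + B * 0"
        by (intro tendsto_intros D)
      ultimately have "y \<le> J P X \<delta> y Sinf + B * c ^ m * c + B * 0"
        by (intro LIMSEQ_le_const[where X = "\<lambda>n. J P X \<delta> y Sinf + B * c ^ m * c + B * D n"]) auto
      then show ?thesis by (simp add: algebra_simps)
    qed
  qed
  have "(\<lambda>m. B * c ^ m) \<longlonglongrightarrow> B * 0"
    using c by (intro tendsto_intros LIMSEQ_realpow_zero) auto
  then have "x - J P X \<delta> x Sinf \<le> B * 0"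
    using contract[OF x] by (intro LIMSEQ_le_const) auto
  then show ?thesis by simp
qed

text \<open>A mild equilibrium that contains \<open>Siter n\<close> but omits \<open>x\<close>
  competes in the supremum for \<open>x\<close>, so adding \<open>x\<close> at the next stage would
  contradict mildness.\<close>

lemma Sinf_subset_mild:
  assumes S: "mild_equilibrium \<X> P X \<delta> S"
  shows "Sinf \<subseteq> S"
proof -
  have "Siter n \<subseteq> S" for n
  proof (induction n)
    case (Suc n)
    show ?case
    proof
      fix x assume x: "x \<in> Siter (Suc n)"
      show "x \<in> S"
      proof (rule ccontr)
        assume nS: "x \<notin> S"
        then have "J P X \<delta> x S < x"
          using Suc x S by (intro Siter_Suc_D[where n = n]) (auto simp: mild_equilibrium_def)
        moreover have "x \<in> \<X>" using x Siter_subset by blast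
        then have "x \<le> J P X \<delta> x S" using S nS by (auto simp: mild_equilibrium_def)
        ultimately show False by simp
      qed
    qed
  qed simp
  then show ?thesis by (auto simp: S_infinity_def)
qed

lemma optimal_mild_Sinf: "optimal_mild_equilibrium \<X> P X \<delta> Sinf"
  unfolding optimal_mild_equilibrium_def
proof (intro conjI allI impI ballI)
  show "mild_equilibrium \<X> P X \<delta> Sinf"
    using Sinf_subset Sinf_le_J by (auto simp: mild_equilibrium_def)
  fix S x assume S: "mild_equilibrium \<X> P X \<delta> S" and x: "x \<in> \<X>"
  \<comment> \<open>\<open>Sinf \<subseteq> S\<close>, and no state has a positive deficit with
    respect to \<open>Sinf\<close>.\<close>
  have "J P X \<delta> x S \<le> J P X \<delta> x Sinf + 0 * 1"
    using val_1_le[OF x order_refl, of S] Sinf_le_J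
    by (intro J_le_J_subset Sinf_subset_mild S x) auto
  then show "J P X \<delta> x S \<le> J P X \<delta> x Sinf" by simp
qed

subsection \<open>The strong equilibrium\<close>

lemma step_filterlim: "filterlim step (at 0 within {0..}) sequentially"
  using step_tendsto step_pos by (auto simp: filterlim_at less_imp_le less_imp_neq[symmetric])

lemma derivative_step_tendsto:
  assumes "(f has_real_derivative D) (at 0 within {0..})"
  shows "(\<lambda>n. (f (step n) - f 0) / step n) \<longlonglongrightarrow> D"
proof -
  have "((\<lambda>u. (f u - f 0) / (u - 0)) \<longlongrightarrow> D) (at 0 within {0..})"
    using assms unfolding has_field_derivative_iff .
  then have "((\<lambda>n. (f (step n) - f 0) / (step n - 0)) \<longlongrightarrow> D) sequentially"
    by (rule filterlim_compose[OF _ step_filterlim])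
  then show ?thesis by simp
qed

lemma trans_prob_0:
  assumes "x \<in> \<X>" "y \<noteq> x"
  shows "trans_prob M P X 0 x y = 0"
proof -
  interpret prob_space "P x" by (rule prob_space_P) fact
  have "prob {\<omega> \<in> space M. X 0 \<omega> = x} + prob {\<omega> \<in> space M. X 0 \<omega> = y} =
      prob ({\<omega> \<in> space M. X 0 \<omega> = x} \<union> {\<omega> \<in> space M. X 0 \<omega> = y})"
    using sets_X[of 0 "{x}"] sets_X[of 0 "{y}"] assms
    by (intro finite_measure_Union[symmetric]) (auto simp: sets_P)
  also have "\<dots> \<le> 1" by (rule prob_le_1)
  finally show ?thesis
    using start[OF assms(1)] by (simp add: trans_prob_def measure_le_0_iff)
qed

lemma rate_nonneg:
  assumes "x \<in> \<X>" "y \<in> \<X>" "x \<noteq> y"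
  shows "0 \<le> q x y"
proof (rule LIMSEQ_le_const)
  show "(\<lambda>n. (trans_prob M P X (step n) x y - trans_prob M P X 0 x y) / step n) \<longlonglongrightarrow> q x y"
    by (intro derivative_step_tendsto rate assms)
  show "\<exists>N. \<forall>n\<ge>N. 0 \<le> (trans_prob M P X (step n) x y - trans_prob M P X 0 x y) / step n"
    using step_pos trans_prob_0[OF assms(1), of y] assms(3)
    by (intro exI[of _ 0]) (simp add: trans_prob_def less_imp_le)
qed

section \<open>First-step analysis and the generator\<close>

lemma grid_val_le_C:
  assumes "x \<in> \<X>" "0 < h" "\<And>y. y \<in> \<X> \<Longrightarrow> f y \<le> C"
  shows "grid_val h \<delta> S f x \<le> C"
proof -
  interpret prob_space "P x" by (rule prob_space_P) fact
  have "grid_val h \<delta> S f x = (\<integral>\<^sup>+\<omega>. grid_payoff 0 h \<delta> S f \<omega> \<partial>P x)"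
    using assms by (simp add: nn_integral_grid_payoff_start)
  also have "\<dots> \<le> (\<integral>\<^sup>+\<omega>. C \<partial>P x)"
    using assms by (intro nn_integral_mono grid_payoff_le) (auto simp: space_P)
  finally show ?thesis by (simp add: emeasure_space_1)
qed

text \<open>Outside \<open>A\<close> the summand of index 0 vanishes, and every other one takes a
  step of length \<open>h\<close> first; supermultiplicativity compares the discounts.\<close>

lemma grid_val_first_step:
  assumes x: "x \<in> \<X>" "x \<notin> A" and h: "0 \<le> h"
  shows "ennreal (\<delta> h) * trans_op h (grid_val h \<delta> A f) x \<le> grid_val h \<delta> A f x"
proof -
  let ?g = "\<lambda>k. ennreal (\<delta> (real k * h)) * hit_val h A f k x"
  have "ennreal (\<delta> h) * trans_op h (grid_val h \<delta> A f) x =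
      (\<Sum>k. ennreal (\<delta> h) * (ennreal (\<delta> (real k * h)) * trans_op h (hit_val h A f k) x))"
    unfolding grid_val_def[abs_def] using x h by (simp add: trans_op_suminf trans_op_cmult)
  also have "\<dots> \<le> (\<Sum>k. ?g (Suc k))"
  proof (intro suminf_le summableI)
    fix k
    have "ennreal (\<delta> h) * ennreal (\<delta> (real k * h)) \<le> ennreal (\<delta> (real (Suc k) * h))"
      using discount_mult'[of h "real k * h"] discount_nonneg h
      by (simp add: ennreal_mult[symmetric] distrib_right ennreal_leI)
    then have "ennreal (\<delta> h) * ennreal (\<delta> (real k * h)) * trans_op h (hit_val h A f k) x
        \<le> ennreal (\<delta> (real (Suc k) * h)) * trans_op h (hit_val h A f k) x"
      by (rule mult_right_mono) simp
    then show "ennreal (\<delta> h) * (ennreal (\<delta> (real k * h)) * trans_op h (hit_val h A f k) x) \<le> ?g (Suc k)"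
      using x by (simp add: mult.assoc)
  qed
  also have "\<dots> \<le> suminf ?g"
  proof (rule suminf_le_const)
    fix n
    have "(\<Sum>k<n. ?g (Suc k)) \<le> sum ?g {..<Suc n}"
      by (subst sum.lessThan_Suc_shift) (simp del: hit_val.simps)
    also have "\<dots> \<le> suminf ?g" by (rule sum_le_suminf) auto
    finally show "(\<Sum>k<n. ?g (Suc k)) \<le> suminf ?g" .
  qed auto
  finally show ?thesis by (simp add: grid_val_def)
qed

text \<open>The first-step inequality on the grid, divided by the mesh size. The factor
  \<open>\<Lambda> x - d\<close> is minus the derivative at 0 of discount times holding probability.
  A finite \<open>F\<close> lets the limit be taken state by state.\<close>

lemma generator_J_le:
  assumes x: "x \<in> \<X>" "x \<notin> A" and F: "finite F" "F \<subseteq> \<X> - {x}"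
    and d: "(\<delta> has_real_derivative d) (at 0 within {0..})"
  shows "(\<Sum>y\<in>F. q x y * J P X \<delta> y A) \<le> (\<Lambda> x - d) * J P X \<delta> x A"
proof -
  let ?p = "\<lambda>n y. trans_prob M P X (step n) x y"
  define G where "G n y = grid_val (step n) \<delta> A ennreal y" for n y
  define g where "g n y = enn2real (G n y)" for n y
  have G: "G n y = ennreal (g n y)" if "y \<in> \<X>" for n y
  proof -
    have "G n y \<le> ennreal B"
      unfolding G_def by (intro grid_val_le_C that step_pos ennreal_state_le)
    then have "G n y < \<top>" by (rule le_less_trans) simp
    then show ?thesis by (simp add: g_def)
  qed
  have g0: "0 \<le> g n y" for n y by (simp add: g_def)
  have g_lim: "(\<lambda>n. g n y) \<longlonglongrightarrow> J P X \<delta> y A" if "y \<in> \<X>" for y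
  proof -
    have "(\<lambda>n. G n y) \<longlonglongrightarrow> ennreal (J P X \<delta> y A)"
      unfolding G_def ennreal_J[OF that] by (rule grid_val_tendsto[OF that ennreal_state_le])
    from tendsto_enn2real[OF this] show ?thesis
      using J_nonneg[OF that, of A] by (simp add: g_def)
  qed
  have ineq: "\<delta> (step n) * (\<Sum>y\<in>F. (?p n y / step n) * g n y) \<le>
      ((1 - \<delta> (step n) * ?p n x) / step n) * g n x" for n
  proof -
    have \<delta>0: "0 \<le> \<delta> (step n)" using step_pos[of n] by (intro discount_nonneg) simp
    have F': "finite (insert x F)" "insert x F \<subseteq> \<X>" "x \<notin> F" using F x(1) by auto
    have "ennreal (\<Sum>y\<in>insert x F. g n y * ?p n y) = (\<Sum>y\<in>insert x F. G n y * ennreal (?p n y))"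
      using F' g0 by (subst sum_ennreal[symmetric])
        (auto simp: trans_prob_def ennreal_mult G subset_iff intro!: sum.cong)
    also have "\<dots> = (\<integral>\<^sup>+y. G n y * ennreal (?p n y) * indicator (insert x F) y \<partial>count_space \<X>)"
      using F' by (subst nn_integral_count_space'[of "insert x F"]) (auto simp: indicator_def intro!: sum.cong)
    also have "\<dots> \<le> (\<integral>\<^sup>+y. G n y * ennreal (?p n y) \<partial>count_space \<X>)"
      by (intro nn_integral_mono) (auto simp: indicator_def)
    also have "\<dots> = trans_op (step n) (grid_val (step n) \<delta> A ennreal) x"
      unfolding G_def using x step_pos by (simp add: trans_op_eq less_imp_le)
    finally have "ennreal (\<delta> (step n)) * ennreal (\<Sum>y\<in>insert x F. g n y * ?p n y) \<le>
        ennreal (\<delta> (step n)) * trans_op (step n) (grid_val (step n) \<delta> A ennreal) x"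
      by (rule mult_left_mono) simp
    also have "\<dots> \<le> ennreal (g n x)"
      using grid_val_first_step[OF x, of "step n" ennreal] step_pos[of n]
      by (simp add: G[OF x(1), symmetric] G_def)
    finally have "\<delta> (step n) * (\<Sum>y\<in>insert x F. g n y * ?p n y) \<le> g n x"
      using g0 \<delta>0 by (simp add: ennreal_mult'[symmetric])
    \<comment> \<open>The term of \<open>x\<close> moves to the right before the division, since
      only the difference from 1 has a limit when divided by the mesh size.\<close>
    then have "\<delta> (step n) * (\<Sum>y\<in>F. ?p n y * g n y) \<le> (1 - \<delta> (step n) * ?p n x) * g n x"
      using F' by (simp add: algebra_simps)
    then have "\<delta> (step n) * (\<Sum>y\<in>F. ?p n y * g n y) / step n \<le> (1 - \<delta> (step n) * ?p n x) * g n x / step n"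
      using step_pos[of n] by (intro divide_right_mono) auto
    then show ?thesis by (simp add: sum_divide_distrib[symmetric])
  qed
  have "continuous (at 0 within {0..}) \<delta>" using d by (rule DERIV_continuous)
  then have "(\<delta> \<longlongrightarrow> 1) (at 0 within {0..})" by (simp add: continuous_within discount_0)
  then have \<delta>_lim: "(\<lambda>n. \<delta> (step n)) \<longlonglongrightarrow> 1" by (rule filterlim_compose[OF _ step_filterlim])
  have "(\<lambda>n. (?p n y - trans_prob M P X 0 x y) / step n) \<longlonglongrightarrow> q x y" if "y \<in> F" for y
    using that F x by (intro derivative_step_tendsto rate) auto
  moreover have "trans_prob M P X 0 x y = 0" if "y \<in> F" for y
    using that F by (intro trans_prob_0 x(1)) auto
  ultimately have p_lim: "(\<lambda>n. ?p n y / step n) \<longlonglongrightarrow> q x y" if "y \<in> F" for y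
    using that by force
  have "((\<lambda>t. \<delta> t * trans_prob M P X t x x) has_real_derivative
      \<delta> 0 * - \<Lambda> x + d * trans_prob M P X 0 x x) (at 0 within {0..})"
    by (rule DERIV_mult'[OF d total_rate[OF x(1)]])
  from tendsto_minus[OF derivative_step_tendsto[OF this]]
  have x_lim: "(\<lambda>n. (1 - \<delta> (step n) * ?p n x) / step n) \<longlonglongrightarrow> \<Lambda> x - d"
    using start[OF x(1)] by (simp add: discount_0 minus_divide_left)
  have "(\<lambda>n. \<delta> (step n) * (\<Sum>y\<in>F. (?p n y / step n) * g n y)) \<longlonglongrightarrow> 1 * (\<Sum>y\<in>F. q x y * J P X \<delta> y A)"
    using F by (intro tendsto_intros \<delta>_lim p_lim g_lim) auto
  moreover have "(\<lambda>n. ((1 - \<delta> (step n) * ?p n x) / step n) * g n x) \<longlonglongrightarrow> (\<Lambda> x - d) * J P X \<delta> x A"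
    by (intro tendsto_intros x_lim g_lim x)
  ultimately have "1 * (\<Sum>y\<in>F. q x y * J P X \<delta> y A) \<le> (\<Lambda> x - d) * J P X \<delta> x A"
    using ineq by (intro LIMSEQ_le) auto
  then show ?thesis by simp
qed

text \<open>The Markov property at time \<open>e\<close>: if the chain is back in \<open>x\<close>,
  it stops at once and receives \<open>\<delta> e * x\<close>; from another state \<open>y\<close>
  the discount for the elapsed time is dropped, leaving \<open>J\<close> at \<open>y\<close>. The
  exact discount at \<open>x\<close> is kept because its derivative decides the sign in
  \<open>strong_Sinf\<close>.\<close>

lemma val_from_le:
  assumes x: "x \<in> \<X>" "x \<in> S" and e: "0 \<le> e"
  shows "val e S ennreal x \<le> trans_op e (\<lambda>y. ennreal (if y = x then \<delta> e * x else J P X \<delta> y S)) x"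
proof -
  interpret prob_space "P x" by (rule prob_space_P[OF x(1)])
  let ?g = "\<lambda>n y. if y = x then ennreal (\<delta> e * x) else grid_val (step n) \<delta> S ennreal y"
  have x0: "0 \<le> x" using x states_nonneg by auto
  have le: "(\<integral>\<^sup>+\<omega>. grid_payoff e (step n) \<delta> S ennreal \<omega> \<partial>P x) \<le> trans_op e (?g n) x" for n
  proof -
    have h: "0 \<le> step n" using step_pos[of n] by simp
    have "(\<integral>\<^sup>+\<omega>. grid_payoff e (step n) \<delta> S ennreal \<omega> \<partial>P x) =
        (\<Sum>k. ennreal (\<delta> (e + real k * step n)) * trans_op e (hit_val (step n) S ennreal k) x)"
      unfolding trans_op_def by (rule nn_integral_grid_payoff[OF e h x(1)])
    also have "\<dots> = trans_op e (\<lambda>y. \<Sum>k. ennreal (\<delta> (e + real k * step n)) * hit_val (step n) S ennreal k y) x"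
      using x e by (simp add: trans_op_suminf trans_op_cmult)
    also have "\<dots> \<le> trans_op e (?g n) x"
    proof (rule trans_op_mono[OF x(1) e])
      fix y assume y: "y \<in> \<X>"
      show "(\<Sum>k. ennreal (\<delta> (e + real k * step n)) * hit_val (step n) S ennreal k y) \<le> ?g n y"
      proof (cases "y = x")
        case True
        have "hit_val (step n) S ennreal k x = 0" if "k \<noteq> 0" for k using that x(2) by (cases k) auto
        then have "(\<Sum>k. ennreal (\<delta> (e + real k * step n)) * hit_val (step n) S ennreal k x) =
            ennreal (\<delta> e) * ennreal x"
          using x(2) by (subst suminf_finite[of "{0}"]) auto
        then show ?thesis using True e x0 by (simp add: ennreal_mult discount_nonneg)
      next
        case False
        have "(\<Sum>k. ennreal (\<delta> (e + real k * step n)) * hit_val (step n) S ennreal k y) \<le>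
            grid_val (step n) \<delta> S ennreal y"
          unfolding grid_val_def using e h
          by (intro suminf_le summableI mult_right_mono ennreal_leI discount_decr) auto
        then show ?thesis using False by simp
      qed
    qed
    finally show ?thesis .
  qed
  have "(\<lambda>n. trans_op e (?g n) x) \<longlonglongrightarrow>
      trans_op e (\<lambda>y. ennreal (if y = x then \<delta> e * x else J P X \<delta> y S)) x"
    unfolding trans_op_def
  proof (rule nn_integral_dominated_convergence[where w = "\<lambda>_. ennreal B"])
    show "(\<lambda>\<omega>. ?g n (X e \<omega>)) \<in> borel_measurable (P x)" for n
      unfolding measurable_P[OF x(1)] by (rule borel_fun_X[OF e])
    show "(\<lambda>\<omega>. ennreal (if X e \<omega> = x then \<delta> e * x else J P X \<delta> (X e \<omega>) S)) \<in> borel_measurable (P x)"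
      unfolding measurable_P[OF x(1)]
      by (rule borel_fun_X[OF e, of "\<lambda>y. ennreal (if y = x then \<delta> e * x else J P X \<delta> y S)"])
    have "\<delta> e * x \<le> 1 * B"
      using e x0 by (intro mult_mono discount_le_1 states_le x) auto
    then have "?g n y \<le> ennreal B" if "y \<in> \<X>" for n y
      using that by (cases "y = x") (simp_all add: ennreal_leI grid_val_le_C step_pos ennreal_state_le)
    then show "AE \<omega> in P x. ?g n (X e \<omega>) \<le> ennreal B" for n
      using X_in_states[OF e] by (intro AE_I2) (simp only: space_P x)
    have "(\<lambda>n. ?g n y) \<longlonglongrightarrow> ennreal (if y = x then \<delta> e * x else J P X \<delta> y S)" if "y \<in> \<X>" for y
      using grid_val_tendsto[OF that ennreal_state_le, where S = S] by (cases "y = x") (auto simp: ennreal_J that)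
    then show "AE \<omega> in P x. (\<lambda>n. ?g n (X e \<omega>)) \<longlonglongrightarrow>
        ennreal (if X e \<omega> = x then \<delta> e * x else J P X \<delta> (X e \<omega>) S)"
      using X_in_states[OF e] by (intro AE_I2) (simp only: space_P x)
  qed (auto simp: emeasure_space_1)
  moreover have "(\<lambda>n. \<integral>\<^sup>+\<omega>. grid_payoff e (step n) \<delta> S ennreal \<omega> \<partial>P x) \<longlonglongrightarrow> val e S ennreal x"
    by (rule grid_payoff_val_tendsto[OF x(1) e ennreal_state_le])
  ultimately show ?thesis using le by (intro LIMSEQ_le) auto
qed

text \<open>Bounding the value by \<open>B\<close> outside \<open>insert x F\<close> leaves finitely
  many transition probabilities, whose derivatives at 0 are the rates.\<close>

lemma J_from_le:
  assumes x: "x \<in> \<X>" "x \<in> S" and e: "0 \<le> e" and F: "finite F" "F \<subseteq> \<X> - {x}"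
  shows "J_from P X \<delta> e x S \<le> B + (\<delta> e * x - B) * trans_prob M P X e x x +
    (\<Sum>y\<in>F. (J P X \<delta> y S - B) * trans_prob M P X e x y)"
proof -
  interpret prob_space "P x" by (rule prob_space_P[OF x(1)])
  define g where "g y = (if y = x then \<delta> e * x else J P X \<delta> y S)" for y
  have x0: "0 \<le> x" using x states_nonneg by auto
  have "\<delta> e * x \<le> 1 * B" using e x0 by (intro mult_mono discount_le_1 states_le x) auto
  then have g: "0 \<le> g y" "g y \<le> B" if "y \<in> \<X>" for y
    using that e x0 by (auto simp: g_def discount_nonneg J_nonneg J_le)
  have meas: "(\<lambda>\<omega>. f (X e \<omega>)) \<in> borel_measurable (P x)" for f :: "real \<Rightarrow> real"
    unfolding measurable_P[OF x(1)] by (rule borel_fun_X[OF e])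
  have Xe: "X e \<omega> \<in> \<X>" if "\<omega> \<in> space (P x)" for \<omega>
    using that X_in_states[OF e] by (simp add: space_P x)
  have int: "integrable (P x) (\<lambda>\<omega>. g (X e \<omega>))"
    by (rule integrable_const_bound[where B = B]) (auto intro!: AE_I2 meas simp: g Xe)
  have ev: "{\<omega> \<in> space M. X e \<omega> = y} \<in> events" for y
    using sets_X[OF e, of "{y}"] by (simp add: sets_P x)
  define I where "I y = (indicator {\<omega> \<in> space M. X e \<omega> = y} :: 'w \<Rightarrow> real)" for y
  have I: "integrable (P x) (I y)" "(\<integral>\<omega>. I y \<omega> \<partial>P x) = trans_prob M P X e x y" for y
  proof -
    show "integrable (P x) (I y)"
      unfolding I_def by (intro integrable_real_indicator ev) (simp add: emeasure_eq_measure)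
    show "(\<integral>\<omega>. I y \<omega> \<partial>P x) = trans_prob M P X e x y"
      unfolding I_def trans_prob_def using sets.Int_space_eq2[OF ev[of y]] by simp
  qed
  let ?F = "insert x F"
  have F': "finite ?F" "x \<notin> F" "?F \<subseteq> \<X>" using F x by auto
  have int': "integrable (P x) (\<lambda>\<omega>. B + (\<Sum>y\<in>?F. (g y - B) * I y \<omega>))"
    by (intro Bochner_Integration.integrable_add integrable_const Bochner_Integration.integrable_sum
        integrable_mult_right I)
  have "ennreal (J_from P X \<delta> e x S) \<le> (\<integral>\<^sup>+\<omega>. ennreal (g (X e \<omega>)) \<partial>P x)"
    using val_from_le[OF x e] by (simp add: ennreal_J_from x e trans_op_def g_def)
  also have "\<dots> = ennreal (\<integral>\<omega>. g (X e \<omega>) \<partial>P x)"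
    by (intro nn_integral_eq_integral int AE_I2 g Xe)
  finally have "J_from P X \<delta> e x S \<le> (\<integral>\<omega>. g (X e \<omega>) \<partial>P x)"
    by (subst (asm) ennreal_le_iff) (auto intro!: integral_nonneg_AE AE_I2 g Xe)
  also have "\<dots> \<le> (\<integral>\<omega>. B + (\<Sum>y\<in>?F. (g y - B) * I y \<omega>) \<partial>P x)"
  proof (rule integral_mono[OF int int'])
    fix \<omega> assume \<omega>: "\<omega> \<in> space (P x)"
    then have I\<omega>: "I y \<omega> = (if y = X e \<omega> then 1 else 0)" for y by (auto simp: I_def space_P x)
    have "(\<Sum>y\<in>?F. (g y - B) * I y \<omega>) = (\<Sum>y\<in>?F. if y = X e \<omega> then g y - B else 0)"
      by (intro sum.cong) (auto simp: I\<omega>)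
    also have "\<dots> = (if X e \<omega> \<in> ?F then g (X e \<omega>) - B else 0)"
      using F'(1) by (simp add: sum.delta' del: sum.insert)
    finally show "g (X e \<omega>) \<le> B + (\<Sum>y\<in>?F. (g y - B) * I y \<omega>)"
      using g(2)[OF Xe[OF \<omega>]] by simp
  qed
  also have "\<dots> = B + (\<integral>\<omega>. (\<Sum>y\<in>?F. (g y - B) * I y \<omega>) \<partial>P x)"
    by (subst Bochner_Integration.integral_add) (auto intro!: Bochner_Integration.integrable_sum I simp: prob_space)
  also have "\<dots> = B + (\<Sum>y\<in>?F. (g y - B) * trans_prob M P X e x y)"
    by (subst Bochner_Integration.integral_sum) (auto intro!: I(1) simp: I(2))
  also have "\<dots> = B + (\<delta> e * x - B) * trans_prob M P X e x x +
      (\<Sum>y\<in>F. (J P X \<delta> y S - B) * trans_prob M P X e x y)"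
  proof -
    have "(\<Sum>y\<in>F. (g y - B) * trans_prob M P X e x y) = (\<Sum>y\<in>F. (J P X \<delta> y S - B) * trans_prob M P X e x y)"
      using F'(2) by (intro sum.cong) (auto simp: g_def)
    then show ?thesis using F' by (simp add: g_def)
  qed
  finally show ?thesis .
qed

text \<open>At the stage just before \<open>x\<close> enters, \<open>Sinf - {x}\<close> is among the
  sets of the supremum, which is below \<open>x\<close>.\<close>

lemma J_remove_less:
  assumes "x \<in> Sinf"
  shows "J P X \<delta> x (Sinf - {x}) < x"
proof -
  define n where "n = (LEAST n. x \<in> Siter n)"
  have ex: "\<exists>n. x \<in> Siter n" using assms by (auto simp: S_infinity_def)
  have n: "x \<in> Siter n" unfolding n_def using ex by (rule LeastI_ex)
  then obtain m where m: "n = Suc m" by (cases n) auto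
  have "x \<notin> Siter m" using not_less_Least[of m "\<lambda>n. x \<in> Siter n"] m by (simp add: n_def)
  then show ?thesis
    using n m Sinf_subset by (intro Siter_Suc_D[where n = m]) (auto simp: S_infinity_def)
qed

lemma strong_Sinf:
  assumes d: "(\<delta> has_real_derivative d) (at 0 within {0..})" "d < 0"
  shows "strong_equilibrium \<X> P X \<delta> Sinf"
  unfolding strong_equilibrium_def
proof (intro conjI ballI Sinf_subset)
  fix x assume "x \<in> \<X> - Sinf"
  then show "x \<le> J P X \<delta> x Sinf" by (intro Sinf_le_J) auto
next
  fix x assume xS: "x \<in> Sinf"
  then have x: "x \<in> \<X>" using Sinf_subset by auto
  define A where "A = Sinf - {x}"
  define w where "w = J P X \<delta> x A"
  have w: "w < x" unfolding w_def A_def by (rule J_remove_less[OF xS])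
  \<comment> \<open>In the comparison of \<open>Sinf\<close> with \<open>A\<close> the excess is
    \<open>x - w\<close> at \<open>x\<close> and 0 at the other states of
    \<open>Sinf\<close>.\<close>
  have J_diff: "J P X \<delta> y Sinf \<le> J P X \<delta> y A + (x - w)" if y: "y \<in> \<X>" for y
  proof -
    have "J P X \<delta> y Sinf \<le> J P X \<delta> y A + (x - w) * 1"
    proof (rule J_le_J_subset[OF _ y])
      show "val 0 Sinf (\<lambda>_. 1) y \<le> ennreal 1" using val_1_le[OF y order_refl] by simp
      fix z assume z: "z \<in> Sinf" "z \<in> \<X>"
      show "z \<le> J P X \<delta> z A + (x - w)"
      proof (cases "z = x")
        case False
        then show ?thesis using z w J_in[of z A] by (simp add: A_def)
      qed (simp add: w_def)
    qed (use w in \<open>auto simp: A_def\<close>)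
    then show ?thesis by simp
  qed
  \<comment> \<open>The margin for the total rate outside \<open>F\<close>: even multiplied by
    \<open>B\<close> it stays below \<open>- d * (x - w)\<close>. The denominator is
    \<open>B + 1\<close> because \<open>B\<close> may be 0.\<close>
  have "0 < - d * (x - w) / (B + 1)" using d(2) w B_nonneg by (intro divide_pos_pos mult_pos_pos) auto
  then have "\<forall>\<^sub>F F in finite_subsets_at_top (\<X> - {x}). \<Lambda> x - - d * (x - w) / (B + 1) < sum (q x) F"
    using total_rate_sum[OF x] unfolding has_sum_def by (intro order_tendstoD(1)) auto
  from eventually_finite_subsets_at_top[THEN iffD1, OF this]
  obtain F where F: "finite F" "F \<subseteq> \<X> - {x}"
    and "\<Lambda> x - - d * (x - w) / (B + 1) < sum (q x) F" by auto
  then have "(\<Lambda> x - sum (q x) F) * (B + 1) < - d * (x - w)"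
    using B_nonneg by (simp add: field_simps)
  moreover have qF: "sum (q x) F \<le> \<Lambda> x"
    using F x by (intro finite_sum_le_has_sum[OF total_rate_sum[OF x]]) (auto intro: rate_nonneg)
  ultimately have small: "B * (\<Lambda> x - sum (q x) F) < - d * (x - w)"
    by (simp add: algebra_simps)
  define \<Phi> where "\<Phi> e = B + (\<delta> e * x - B) * trans_prob M P X e x x +
      (\<Sum>y\<in>F. (J P X \<delta> y Sinf - B) * trans_prob M P X e x y)" for e
  \<comment> \<open>The right derivative at 0 of the upper bound \<open>\<Phi>\<close>.\<close>
  define D where "D = d * x - (x - B) * \<Lambda> x + (\<Sum>y\<in>F. (J P X \<delta> y Sinf - B) * q x y)"
  have "(\<Phi> has_real_derivative
      0 + ((\<delta> 0 * x - B) * - \<Lambda> x + (d * x - 0) * trans_prob M P X 0 x x) +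
      (\<Sum>y\<in>F. (J P X \<delta> y Sinf - B) * q x y)) (at 0 within {0..})"
    unfolding \<Phi>_def
    using F x by (intro DERIV_add DERIV_const DERIV_mult' DERIV_diff DERIV_cmult_right DERIV_sum DERIV_cmult d
        total_rate rate) auto
  then have \<Phi>: "(\<Phi> has_real_derivative D) (at 0 within {0..})"
    using start[OF x] by (simp add: D_def discount_0 algebra_simps)
  have \<Phi>0: "\<Phi> 0 = x"
  proof -
    have "(\<Sum>y\<in>F. (J P X \<delta> y Sinf - B) * trans_prob M P X 0 x y) = 0"
      using F trans_prob_0[OF x] by (intro sum.neutral) auto
    then show ?thesis using start[OF x] by (simp add: \<Phi>_def discount_0)
  qed
  have "(\<Sum>y\<in>F. J P X \<delta> y Sinf * q x y) \<le> (\<Sum>y\<in>F. q x y * J P X \<delta> y A + (x - w) * q x y)"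
  proof (rule sum_mono)
    fix y assume y: "y \<in> F"
    then have "0 \<le> q x y" using F x by (intro rate_nonneg) auto
    then have "J P X \<delta> y Sinf * q x y \<le> (J P X \<delta> y A + (x - w)) * q x y"
      using y F by (intro mult_right_mono J_diff) auto
    then show "J P X \<delta> y Sinf * q x y \<le> q x y * J P X \<delta> y A + (x - w) * q x y"
      by (simp add: algebra_simps)
  qed
  also have "\<dots> = (\<Sum>y\<in>F. q x y * J P X \<delta> y A) + (x - w) * sum (q x) F"
    by (simp add: sum.distrib sum_distrib_left)
  also have "\<dots> \<le> (\<Lambda> x - d) * w + (x - w) * \<Lambda> x"
    using generator_J_le[OF x _ F d(1), of A] qF w
    by (intro add_mono mult_left_mono) (auto simp: A_def w_def)
  \<comment> \<open>The terms with \<open>\<Lambda> x\<close> combine to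
    \<open>D \<le> d * (x - w) + B * (\<Lambda> x - sum (q x) F)\<close>, which is negative by the
    choice of \<open>F\<close>.\<close>
  finally have "D < 0"
    using small unfolding D_def by (simp add: algebra_simps sum_subtractf sum_distrib_left)
  from has_real_derivative_neg_dec_right[OF \<Phi> this]
  obtain \<epsilon> where \<epsilon>: "0 < \<epsilon>" "\<And>h. 0 < h \<Longrightarrow> h < \<epsilon> \<Longrightarrow> \<Phi> h < \<Phi> 0" by auto
  show "\<exists>\<epsilon>>0. \<forall>\<epsilon>'\<in>{0<..<\<epsilon>}. J_from P X \<delta> \<epsilon>' x Sinf \<le> x"
  proof (intro exI[of _ \<epsilon>] conjI ballI \<epsilon>(1))
    fix e assume e: "e \<in> {0<..<\<epsilon>}"
    then have "J_from P X \<delta> e x Sinf \<le> \<Phi> e"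
      unfolding \<Phi>_def by (intro J_from_le x xS F) auto
    also have "\<Phi> e < x" using \<epsilon>(2)[of e] e by (simp add: \<Phi>0)
    finally show "J_from P X \<delta> e x Sinf \<le> x" by simp
  qed
qed

end

theorem theorem2p2:
  fixes \<X> :: "real set"
    and M :: "'w measure"
    and P :: "real \<Rightarrow> 'w measure"
    and X :: "real \<Rightarrow> 'w \<Rightarrow> real"
    and q :: "real \<Rightarrow> real \<Rightarrow> real"
    and \<Lambda> :: "real \<Rightarrow> real"
    and \<delta> :: "real \<Rightarrow> real"
  assumes chain: "ctmc \<X> M P X q \<Lambda>"
    and discount: "discount_function \<delta>"
    and bounded_states: "bdd_above \<X>"
    and bounded_rates: "bdd_above (\<Lambda> ` \<X>)"
    and supermult: "\<And>s t. 0 < s \<Longrightarrow> 0 < t \<Longrightarrow> \<delta> s * \<delta> t \<le> \<delta> (s + t)"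
  shows "optimal_mild_equilibrium \<X> P X \<delta> (S_infinity \<X> P X \<delta>) \<and>
    ((\<exists>d<0. (\<delta> has_real_derivative d) (at 0 within {0..})) \<longrightarrow>
      strong_equilibrium \<X> P X \<delta> (S_infinity \<X> P X \<delta>))"
proof -
  interpret ctmc \<X> M P X q \<Lambda> by (rule chain)
  obtain b where b: "\<And>x. x \<in> \<X> \<Longrightarrow> x \<le> b" using bounded_states by (auto simp: bdd_above_def)
  obtain l where l: "\<And>x. x \<in> \<X> \<Longrightarrow> \<Lambda> x \<le> l" using bounded_rates by (auto simp: bdd_above_def)
  \<comment> \<open>\<open>max 0\<close> makes both bounds nonnegative, and adding 1 makes the bound
    on the rates strict.\<close>
  interpret discounted_ctmc \<X> M P X q \<Lambda> \<delta> "max 0 b" "max 0 l + 1"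
  proof unfold_locales
    show "x \<le> max 0 b" if "x \<in> \<X>" for x using b[OF that] by simp
    show "\<Lambda> x < max 0 l + 1" if "x \<in> \<X>" for x using l[OF that] by simp
  qed (use discount supermult in auto)
  show ?thesis using optimal_mild_Sinf strong_Sinf by blast
qed

end
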